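(* Let $\mathbf{k}$ be a commutative unitary ring, $\lambda\in\mathbf{k}$, and let $X$ be a set. Let $\mathrm{Sh}^{NC}(X)$ be the free $\mathbf{k}$-module on the set $X^{\mathcal F}$ of angularly decorated planar rooted forests with decoration set $X$. For $D=(F;(x_1,\dots,x_n))$ and $D'=(F';(x'_1,\dots,x'_{n'}))$ in $X^{\mathcal F}$ (with $n=\ell(F)-1$, $n'=\ell(F')-1$), define $$D\,\overline{\diamond}\,D'=\begin{cases}(\bullet;\mathbf 1), & F=F'=\bullet,\\ D, & F'=\bullet,\ F\ne\bullet,\\ D', & F=\bullet,\ F'\neq\bullet,\\ (F\diamond F';(x_1,\dots,x_n,x'_1,\dots,x'_{n'})), & F\ne\bullet,\ F'\neq\bullet,\end{cases}$$ where $\diamond$ is the product of forests of weight $\lambda$ defined in the context, and extend $\overline{\diamond}$ bilinearly. Define the $\mathbf{k}$-linear map $$P_X:\mathrm{Sh}^{NC}(X)\to\mathrm{Sh}^{NC}(X),\quad P_X(F;(x_1,\dots,x_n))=(\lfloor F\rfloor;(x_1,\dots,x_n)),$$ and the map $$j_X:X\to\mathrm{Sh}^{NC}(X),\quad j_X(x)=(\bullet\sqcup\bullet;(x)).$$ Then the quadruple $(\mathrm{Sh}^{NC}(X),\overline{\diamond},P_X,j_X)$ is the free (unitary) Rota--Baxter algebra of weight $\lambda$ on $X$; that is, $(\mathrm{Sh}^{NC}(X),\overline{\diamond},P_X)$ is a unitary Rota--Baxter algebra of weight $\lambda$, and for any unitary Rota--Baxter algebra $(R,P)$ of weight $\lambda$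 and any map $f:X\to R$ there is a unique unitary Rota--Baxter algebra morphism $\bar f:\mathrm{Sh}^{NC}(X)\to R$ with $\bar f\circ j_X=f$.
   Context: Rota--Baxter algebra of weight $\lambda$: an associative $\mathbf{k}$-algebra $R$ with a $\mathbf{k}$-linear map $P:R\to R$ such that $P(x)P(y)=P\big(P(x)y+xP(y)+\lambda xy\big)$ for all $x,y\in R$; it is unitary if $R$ has an identity. A morphism of unitary Rota--Baxter algebras is a unit-preserving $\mathbf{k}$-algebra homomorphism commuting with the operators. Forests: $\mathcal{T}$ is the set of planar rooted trees; $\bullet$ is the tree with a single vertex. $\mathcal{F}$ is the free semigroup generated by $\mathcal{T}$, with product (concatenation) denoted $\sqcup$; its elements $T_1\sqcup\cdots\sqcup T_b$ ($b\ge 1$, $T_i\in\mathcal{T}$) are called planar rooted forests. The grafting $\lfloor T_1\sqcup\cdots\sqcup T_b\rfloor$ is the tree obtained by adding a new root together with an edge from the new root to the root of each $T_i$ (keeping the order). Every tree is either $\bullet$ or of the form $\lfloor \overline{F}\rfloor$ for a unique forest $\overline{F}$. The depth of a tree is the length of the longest path from its root to a leaf; the depth $\mathrm{d}(F)$ of a forest is the maximal depth of its trees. $\ell(F)$ denotes the number of leaves of $F$ (with $\ell(\bullet)=1$). The product $\sqcup$ and the grafting $\lfloor\ \rfloor$ are extended (bi)linearly to $\mathbf{k}\,\mathcal{F}$, the free $\mathbf{k}$-module on $\mathcal F$. Product $\diamond$ on $\mathbf{k}\,\mathcal{F}$: defined on $\mathcal{F}\times\mathcal{F}$ by induction on $\mathrm{d}(F)+\mathrm{d}(F')$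 and extended bilinearly. For trees $F,F'$: $F\diamond\bullet=F$, $\bullet\diamond F'=F'$, and if $F=\lfloor\overline{F}\rfloor$, $F'=\lfloor\overline{F}'\rfloor$ then $$F\diamond F'=\lfloor\lfloor\overline{F}\rfloor\diamond\overline{F}'\rfloor+\lfloor\overline{F}\diamond\lfloor\overline{F}'\rfloor\rfloor+\lambda\lfloor\overline{F}\diamond\overline{F}'\rfloor .$$ For forests $F=T_1\sqcup\cdots\sqcup T_b$ and $F'=T'_1\sqcup\cdots\sqcup T'_{b'}$, $F\diamond F'=T_1\sqcup\cdots\sqcup T_{b-1}\sqcup(T_b\diamond T'_1)\sqcup T'_2\sqcup\cdots\sqcup T'_{b'}$. The element $F\diamond F'$ is a linear combination of forests each having $\ell(F)+\ell(F')-1$ leaves. Decorated forests: for $F\in\mathcal{F}$, $X^F=\{(F;\vec x)\mid\vec x\in X^{\ell(F)-1}\}$, with the convention $X^0=\{\mathbf 1\}$ (the empty tuple, which is dropped in concatenations of tuples). $X^{\mathcal F}=\coprod_{F\in\mathcal{F}}X^F$. If $\sum_ic_iF_i\in\mathbf{k}\,\mathcal{F}$ with all $F_i$ having $\ell$ leaves and $\vec x\in X^{\ell-1}$, then $(\sum_i c_iF_i;\vec x):=\sum_i c_i(F_i;\vec x)$. *)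

theory Defs
  imports "HOL-Algebra.Module"
begin

section \<open>Rota--Baxter algebras\<close>

text \<open>
  A \<^const>\<open>ring\<close> is associative with identity but need be neither commutative nor nontrivial, so
  the next locale describes associative unitary algebras.
  (The locale \<^locale>\<open>algebra\<close> of the library is restricted to commutative algebras.)
\<close>

locale unitary_algebra = module K A + ring A for K (structure) and A (structure) +
  assumes smult_mult_left:
      "\<lbrakk>a \<in> carrier K; x \<in> carrier A; y \<in> carrier A\<rbrakk> \<Longrightarrow>
       (a \<odot>\<^bsub>A\<^esub> x) \<otimes>\<^bsub>A\<^esub> y = a \<odot>\<^bsub>A\<^esub> (x \<otimes>\<^bsub>A\<^esub> y)"
    and smult_mult_right:
      "\<lbrakk>a \<in> carrier K; x \<in> carrier A; y \<in> carrier A\<rbrakk> \<Longrightarrow>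
       x \<otimes>\<^bsub>A\<^esub> (a \<odot>\<^bsub>A\<^esub> y) = a \<odot>\<^bsub>A\<^esub> (x \<otimes>\<^bsub>A\<^esub> y)"

definition linear_maps ::
    "('k, 'm) ring_scheme \<Rightarrow> ('k, 'a, 'n) module_scheme \<Rightarrow> ('k, 'b, 'l) module_scheme \<Rightarrow> ('a \<Rightarrow> 'b) set"
  where "linear_maps K A B =
    {h \<in> carrier A \<rightarrow> carrier B.
       (\<forall>x\<in>carrier A. \<forall>y\<in>carrier A. h (x \<oplus>\<^bsub>A\<^esub> y) = h x \<oplus>\<^bsub>B\<^esub> h y) \<and>
       (\<forall>a\<in>carrier K. \<forall>x\<in>carrier A. h (a \<odot>\<^bsub>A\<^esub> x) = a \<odot>\<^bsub>B\<^esub> h x)}"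

locale unitary_rota_baxter_algebra = unitary_algebra K A
  for K (structure) and lam and A (structure) and P +
  assumes weight_closed: "lam \<in> carrier K"
    and operator_linear: "P \<in> linear_maps K A A"
    and rota_baxter:
      "\<lbrakk>x \<in> carrier A; y \<in> carrier A\<rbrakk> \<Longrightarrow>
       P x \<otimes>\<^bsub>A\<^esub> P y =
       P ((P x \<otimes>\<^bsub>A\<^esub> y) \<oplus>\<^bsub>A\<^esub> (x \<otimes>\<^bsub>A\<^esub> P y) \<oplus>\<^bsub>A\<^esub> (lam \<odot>\<^bsub>A\<^esub> (x \<otimes>\<^bsub>A\<^esub> y)))"

text \<open>Morphisms are made \<^const>\<open>extensional\<close> so that equality of functions is equality on the
  carrier; \<^const>\<open>ring_hom\<close> includes preservation of the unit.\<close>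

definition rota_baxter_morphisms ::
    "('k, 'm) ring_scheme \<Rightarrow> ('k, 'a, 'n) module_scheme \<Rightarrow> ('a \<Rightarrow> 'a) \<Rightarrow>
     ('k, 'b, 'l) module_scheme \<Rightarrow> ('b \<Rightarrow> 'b) \<Rightarrow> ('a \<Rightarrow> 'b) set"
  where "rota_baxter_morphisms K A P B Q =
    {h \<in> ring_hom A B \<inter> linear_maps K A B \<inter> extensional (carrier A).
       \<forall>x\<in>carrier A. h (P x) = Q (h x)}"


section \<open>Free modules\<close>

text \<open>The free module on a set \<open>B\<close> consists of the finitely supported functions vanishing
  outside \<open>B\<close>. The ring fields of the record play no role for a module and are left unspecified.\<close>

definition free_module :: "('k, 'm) ring_scheme \<Rightarrow> 'b set \<Rightarrow> ('k, 'b \<Rightarrow> 'k) module"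
  where "free_module K B =
    \<lparr>carrier = {v. (\<forall>b. v b \<in> carrier K) \<and> {b. v b \<noteq> \<zero>\<^bsub>K\<^esub>} \<subseteq> B \<and> finite {b. v b \<noteq> \<zero>\<^bsub>K\<^esub>}},
     mult = undefined,
     one = undefined,
     zero = (\<lambda>b. \<zero>\<^bsub>K\<^esub>),
     add = (\<lambda>v w b. v b \<oplus>\<^bsub>K\<^esub> w b),
     smult = (\<lambda>a v b. a \<otimes>\<^bsub>K\<^esub> v b)\<rparr>"

definition basis_vec :: "('k, 'm) ring_scheme \<Rightarrow> 'b \<Rightarrow> 'b \<Rightarrow> 'k"
  where "basis_vec K b = (\<lambda>c. if c = b then \<one>\<^bsub>K\<^esub> else \<zero>\<^bsub>K\<^esub>)"

definition lin_ext ::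
    "('k, 'm) ring_scheme \<Rightarrow> ('k, 'a, 'n) module_scheme \<Rightarrow> ('b \<Rightarrow> 'a) \<Rightarrow> ('b \<Rightarrow> 'k) \<Rightarrow> 'a"
  where "lin_ext K M g v = (\<Oplus>\<^bsub>M\<^esub>b\<in>{b. v b \<noteq> \<zero>\<^bsub>K\<^esub>}. v b \<odot>\<^bsub>M\<^esub> g b)"

definition bilin_ext ::
    "('k, 'm) ring_scheme \<Rightarrow> ('k, 'a, 'n) module_scheme \<Rightarrow> ('b \<Rightarrow> 'c \<Rightarrow> 'a) \<Rightarrow>
     ('b \<Rightarrow> 'k) \<Rightarrow> ('c \<Rightarrow> 'k) \<Rightarrow> 'a"
  where "bilin_ext K M g v w = lin_ext K M (\<lambda>b. lin_ext K M (g b) w) v"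


section \<open>Planar rooted forests\<close>

text \<open>A tree is given by the list of the subtrees of its root, so \<open>Node []\<close> is the tree with a
  single vertex. A forest is a nonempty list of trees, concatenation of forests is \<open>@\<close>, and the
  grafting of a forest \<open>F\<close> is \<open>Node F\<close>.\<close>

datatype ptree = Node (subtrees: "ptree list")

type_synonym pforest = "ptree list"

abbreviation bullet :: ptree where "bullet \<equiv> Node []"

definition forests :: "pforest set"
  where "forests = {F. F \<noteq> []}"

fun tree_leaves :: "ptree \<Rightarrow> nat"
  where "tree_leaves (Node F) = (if F = [] then 1 else (\<Sum>T\<leftarrow>F. tree_leaves T))"

definition leaves :: "pforest \<Rightarrow> nat"
  where "leaves F = (\<Sum>T\<leftarrow>F. tree_leaves T)"

abbreviation forest_module :: "('k, 'm) ring_scheme \<Rightarrow> ('k, pforest \<Rightarrow> 'k) module"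
  where "forest_module K \<equiv> free_module K forests"

definition graft_lin :: "('k, 'm) ring_scheme \<Rightarrow> (pforest \<Rightarrow> 'k) \<Rightarrow> (pforest \<Rightarrow> 'k)"
  where "graft_lin K = lin_ext K (forest_module K) (\<lambda>F. basis_vec K [Node F])"

text \<open>The linear extension of \<open>G \<mapsto> A \<squnion> G \<squnion> C\<close>, where \<open>A\<close> and \<open>C\<close> may be empty lists.\<close>

definition concat_lin ::
    "('k, 'm) ring_scheme \<Rightarrow> pforest \<Rightarrow> (pforest \<Rightarrow> 'k) \<Rightarrow> pforest \<Rightarrow> (pforest \<Rightarrow> 'k)"
  where "concat_lin K A v C = lin_ext K (forest_module K) (\<lambda>G. basis_vec K (A @ G @ C)) v"

text \<open>The product \<open>\<diamond>\<close> of two trees and of two forests. The value of \<open>forest_prod\<close> on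
  empty lists, which are not forests, is irrelevant.\<close>

function tree_prod :: "('k, 'm) ring_scheme \<Rightarrow> 'k \<Rightarrow> ptree \<Rightarrow> ptree \<Rightarrow> (pforest \<Rightarrow> 'k)"
  and forest_prod :: "('k, 'm) ring_scheme \<Rightarrow> 'k \<Rightarrow> pforest \<Rightarrow> pforest \<Rightarrow> (pforest \<Rightarrow> 'k)"
  where
    "tree_prod K lam T T' =
      (if T' = bullet then basis_vec K [T]
       else if T = bullet then basis_vec K [T']
       else graft_lin K (forest_prod K lam [T] (subtrees T'))
              \<oplus>\<^bsub>forest_module K\<^esub> graft_lin K (forest_prod K lam (subtrees T) [T'])
              \<oplus>\<^bsub>forest_module K\<^esub>
                lam \<odot>\<^bsub>forest_module K\<^esub> graft_lin K (forest_prod K lam (subtrees T) (subtrees T')))"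
  | "forest_prod K lam F F' =
      (if F = [] \<or> F' = [] then \<zero>\<^bsub>forest_module K\<^esub>
       else concat_lin K (butlast F) (tree_prod K lam (last F) (hd F')) (tl F'))"
  by pat_completeness auto

termination
proof -
  have sub: "sum_list (map size (subtrees T)) < size T" for T
  proof -
    have "sum_list (map size F) \<le> size_list size F" for F :: pforest
      by (induction F) auto
    then show ?thesis by (cases T) (simp add: less_Suc_eq_le)
  qed
  have mem: "size T \<le> sum_list (map size F)" if "T \<in> set F" for T and F :: pforest
    using that by (simp add: member_le_sum_list)
  show ?thesis
  proof (relation "measure (\<lambda>x. case x of
        Inl (K, lam, T, T') \<Rightarrow> 2 * (size T + size T')
      | Inr (K, lam, F, F') \<Rightarrow> 2 * (sum_list (map size F) + sum_list (map size F')) + 1)", goal_cases)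
    case 1
    show ?case by simp
  next
    case (2 K lam T T')
    show ?case using sub[of T'] by simp
  next
    case (3 K lam T T')
    show ?case using sub[of T] by simp
  next
    case (4 K lam T T')
    show ?case using sub[of T] sub[of T'] by simp
  next
    case (5 K lam F F')
    then show ?case using mem[of "last F" F] mem[of "hd F'" F'] by simp
  qed
qed

declare tree_prod.simps [simp del] forest_prod.simps [simp del]


section \<open>Angularly decorated forests\<close>

type_synonym 'x dforest = "pforest \<times> 'x list"

definition decorated_forests :: "'x set \<Rightarrow> 'x dforest set"
  where "decorated_forests X =
    {(F, xs). F \<in> forests \<and> set xs \<subseteq> X \<and> length xs = leaves F - 1}"

text \<open>The element \<open>(\<Sum>c\<^sub>iF\<^sub>i; xs) = \<Sum>c\<^sub>i(F\<^sub>i; xs)\<close>.\<close>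

definition decorate ::
    "('k, 'm) ring_scheme \<Rightarrow> 'x set \<Rightarrow> (pforest \<Rightarrow> 'k) \<Rightarrow> 'x list \<Rightarrow> ('x dforest \<Rightarrow> 'k)"
  where "decorate K X v xs =
    lin_ext K (free_module K (decorated_forests X)) (\<lambda>F. basis_vec K (F, xs)) v"

definition dforest_prod ::
    "('k, 'm) ring_scheme \<Rightarrow> 'k \<Rightarrow> 'x set \<Rightarrow> 'x dforest \<Rightarrow> 'x dforest \<Rightarrow> ('x dforest \<Rightarrow> 'k)"
  where "dforest_prod K lam X D D' =
    (case (D, D') of ((F, xs), (F', xs')) \<Rightarrow>
       if F = [bullet] \<and> F' = [bullet] then basis_vec K ([bullet], [])
       else if F' = [bullet] then basis_vec K D
       else if F = [bullet] then basis_vec K D'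
       else decorate K X (forest_prod K lam F F') (xs @ xs'))"

definition ShNC ::
    "('k, 'm) ring_scheme \<Rightarrow> 'k \<Rightarrow> 'x set \<Rightarrow> ('k, 'x dforest \<Rightarrow> 'k) module"
  where "ShNC K lam X =
    (free_module K (decorated_forests X))
      \<lparr>mult := bilin_ext K (free_module K (decorated_forests X)) (dforest_prod K lam X),
       one := basis_vec K ([bullet], [])\<rparr>"

definition ShNC_op ::
    "('k, 'm) ring_scheme \<Rightarrow> 'x set \<Rightarrow> ('x dforest \<Rightarrow> 'k) \<Rightarrow> ('x dforest \<Rightarrow> 'k)"
  where "ShNC_op K X =
    lin_ext K (free_module K (decorated_forests X)) (\<lambda>(F, xs). basis_vec K ([Node F], xs))"

definition ShNC_gen :: "('k, 'm) ring_scheme \<Rightarrow> 'x \<Rightarrow> ('x dforest \<Rightarrow> 'k)"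
  where "ShNC_gen K x = basis_vec K ([bullet, bullet], [x])"

end

theory Submission
  imports Defs
begin

text \<open>
  Write \<open>1\<close> for the one-vertex tree without decorations, \<open>P\<close> for grafting and, for decorated
  forests \<open>D = (F; xs)\<close> and \<open>E = (G; ys)\<close>, write \<open>D \<squnion>\<^sub>x E\<close> for \<open>(F \<squnion> G; xs, x, ys)\<close>: the decoration
  \<open>x\<close> sits in the angle between the last leaf of \<open>F\<close> and the first leaf of \<open>G\<close>. Every decorated
  forest arises from \<open>1\<close> by grafting and by these joins (\<open>decorated_forest_cases\<close>), and the product
  is governed by four laws that say what it does to each of the constructors:
  \<^item> \<open>1\<close> is a unit;
  \<^item> \<open>(u \<squnion>\<^sub>x v) \<diamond> w = u \<squnion>\<^sub>x (v \<diamond> w)\<close> and \<open>u \<diamond> (v \<squnion>\<^sub>x w) = (u \<diamond> v) \<squnion>\<^sub>x w\<close>, because the product of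
    forests only touches the two adjacent trees (\<open>dprod_join_left\<close>, \<open>dprod_join_right\<close>);
  \<^item> the Rota--Baxter identity, which is the defining recursion for a product of two grafted
    trees (\<open>dprod_rota_baxter\<close>).

  Associativity follows by induction on the total size of three basis elements. The unit and join
  laws dispose of every case but that of three grafted trees; there the Rota--Baxter identity turns
  both sides into \<open>P\<close> of seven terms, and these match by the induction hypothesis
  (\<open>dprod_assoc_basis\<close>).

  The unit and join laws also give \<open>u \<squnion>\<^sub>x v = u \<diamond> j(x) \<diamond> v\<close> (\<open>join_prod_eq_dprod\<close>). So \<open>1\<close>, the
  operator, the product and the elements \<open>j(x)\<close> reach every basis element, which makes a morphism
  unique (\<open>morphism_unique\<close>), and dictates its values: \<open>1\<close> goes to the unit, grafting becomes the
  operator of the target and \<open>\<squnion>\<^sub>x\<close> becomes the product with \<open>f x\<close> in the middle. Reading a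
  decorated forest in this way defines \<open>eval_forest\<close>; its linear extension is multiplicative by an
  induction that again uses the four laws, now against the product and operator of the target
  (\<open>eval_lin_prod_basis\<close>).
\<close>

section \<open>Linear and bilinear maps on free modules\<close>

lemma linear_mapsD:
  assumes "h \<in> linear_maps K A B"
  shows linear_maps_closed: "x \<in> carrier A \<Longrightarrow> h x \<in> carrier B"
    and linear_maps_add: "\<lbrakk>x \<in> carrier A; y \<in> carrier A\<rbrakk> \<Longrightarrow> h (x \<oplus>\<^bsub>A\<^esub> y) = h x \<oplus>\<^bsub>B\<^esub> h y"
    and linear_maps_smult:
      "\<lbrakk>a \<in> carrier K; x \<in> carrier A\<rbrakk> \<Longrightarrow> h (a \<odot>\<^bsub>A\<^esub> x) = a \<odot>\<^bsub>B\<^esub> h x"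
  using assms by (auto simp: linear_maps_def)

lemma linear_mapsI:
  assumes "\<And>x. x \<in> carrier A \<Longrightarrow> h x \<in> carrier B"
    and "\<And>x y. \<lbrakk>x \<in> carrier A; y \<in> carrier A\<rbrakk> \<Longrightarrow> h (x \<oplus>\<^bsub>A\<^esub> y) = h x \<oplus>\<^bsub>B\<^esub> h y"
    and "\<And>a x. \<lbrakk>a \<in> carrier K; x \<in> carrier A\<rbrakk> \<Longrightarrow> h (a \<odot>\<^bsub>A\<^esub> x) = a \<odot>\<^bsub>B\<^esub> h x"
  shows "h \<in> linear_maps K A B"
  using assms by (auto simp: linear_maps_def)

lemma linear_maps_ident: "(\<lambda>x. x) \<in> linear_maps K A A"
  by (rule linear_mapsI) auto

lemma linear_maps_compose:
  assumes "h \<in> linear_maps K A B" and "g \<in> linear_maps K B C"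
  shows "(\<lambda>x. g (h x)) \<in> linear_maps K A C"
  using assms by (auto simp: linear_maps_def Pi_iff)

lemma linear_maps_plus:
  assumes "module K B" and "h \<in> linear_maps K A B" and "g \<in> linear_maps K A B"
  shows "(\<lambda>x. h x \<oplus>\<^bsub>B\<^esub> g x) \<in> linear_maps K A B"
proof -
  interpret B: module K B by fact
  note [simp] = linear_mapsD[OF assms(2)] linear_mapsD[OF assms(3)]
  show ?thesis
    by (rule linear_mapsI) (simp_all add: B.M.a_ac B.smult_r_distr)
qed

lemma linear_maps_scale:
  assumes "module K B" and "h \<in> linear_maps K A B" and "c \<in> carrier K"
  shows "(\<lambda>x. c \<odot>\<^bsub>B\<^esub> h x) \<in> linear_maps K A B"
proof -
  interpret B: module K B by fact
  note [simp] = linear_mapsD[OF assms(2)] assms(3)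
  show ?thesis
    by (rule linear_mapsI)
      (simp_all add: B.smult_r_distr B.smult_assoc1[symmetric] B.R.m_comm)
qed

definition bilinear_maps ::
    "('k, 'm) ring_scheme \<Rightarrow> ('k, 'a, 'n) module_scheme \<Rightarrow> ('k, 'b, 'l) module_scheme \<Rightarrow>
     ('k, 'c, 'q) module_scheme \<Rightarrow> ('a \<Rightarrow> 'b \<Rightarrow> 'c) set"
  where "bilinear_maps K A B C =
    {m. (\<forall>y\<in>carrier B. (\<lambda>x. m x y) \<in> linear_maps K A C) \<and>
        (\<forall>x\<in>carrier A. m x \<in> linear_maps K B C)}"

lemma bilinear_mapsD:
  assumes "m \<in> bilinear_maps K A B C"
  shows bilinear_left: "y \<in> carrier B \<Longrightarrow> (\<lambda>x. m x y) \<in> linear_maps K A C"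
    and bilinear_right: "x \<in> carrier A \<Longrightarrow> m x \<in> linear_maps K B C"
    and bilinear_closed: "\<lbrakk>x \<in> carrier A; y \<in> carrier B\<rbrakk> \<Longrightarrow> m x y \<in> carrier C"
  using assms by (auto simp: bilinear_maps_def linear_maps_closed)

lemma bilinear_maps_compose:
  assumes m: "m \<in> bilinear_maps K A B C" and h: "h \<in> linear_maps K A' A"
    and g: "g \<in> linear_maps K B' B" and k: "k \<in> linear_maps K C C'"
  shows "(\<lambda>x y. k (m (h x) (g y))) \<in> bilinear_maps K A' B' C'"
  unfolding bilinear_maps_def
  using linear_maps_compose[OF linear_maps_compose[OF h bilinear_left[OF m]] k]
    linear_maps_compose[OF linear_maps_compose[OF g bilinear_right[OF m]] k]
    linear_maps_closed[OF h] linear_maps_closed[OF g]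
  by auto

lemma bilinear_maps_plus:
  assumes "module K C" and "m \<in> bilinear_maps K A B C" and "m' \<in> bilinear_maps K A B C"
  shows "(\<lambda>x y. m x y \<oplus>\<^bsub>C\<^esub> m' x y) \<in> bilinear_maps K A B C"
  using assms by (auto simp: bilinear_maps_def intro!: linear_maps_plus)

lemma bilinear_maps_scale:
  assumes "module K C" and "m \<in> bilinear_maps K A B C" and "c \<in> carrier K"
  shows "(\<lambda>x y. c \<odot>\<^bsub>C\<^esub> m x y) \<in> bilinear_maps K A B C"
  using assms by (auto simp: bilinear_maps_def intro!: linear_maps_scale)

text \<open>These rewrite module operations to pointwise ones and so hide them from the rules for
  linear maps; they are therefore applied only where coefficients are compared.\<close>

lemma free_module_simps:
  "\<zero>\<^bsub>free_module K B\<^esub> = (\<lambda>b. \<zero>\<^bsub>K\<^esub>)"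
  "v \<oplus>\<^bsub>free_module K B\<^esub> w = (\<lambda>b. v b \<oplus>\<^bsub>K\<^esub> w b)"
  "a \<odot>\<^bsub>free_module K B\<^esub> v = (\<lambda>b. a \<otimes>\<^bsub>K\<^esub> v b)"
  by (simp_all add: free_module_def)

lemma carrier_free_module:
  "v \<in> carrier (free_module K B) \<longleftrightarrow>
    (\<forall>b. v b \<in> carrier K) \<and> {b. v b \<noteq> \<zero>\<^bsub>K\<^esub>} \<subseteq> B \<and> finite {b. v b \<noteq> \<zero>\<^bsub>K\<^esub>}"
  by (simp add: free_module_def)

lemma free_module_mono: "B \<subseteq> C \<Longrightarrow> carrier (free_module K B) \<subseteq> carrier (free_module K C)"
  unfolding subset_iff carrier_free_module by blast

lemma linear_maps_subbasis:
  assumes "h \<in> linear_maps K (free_module K C) A" and "B \<subseteq> C"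
  shows "h \<in> linear_maps K (free_module K B) A"
  using assms(1) free_module_mono[OF assms(2), of K]
  by (auto simp: linear_maps_def Pi_iff subset_iff free_module_simps)

locale coefficient_ring = cring K for K (structure)
begin

lemma free_module_plus_closed:
  assumes "v \<in> carrier (free_module K B)" and "w \<in> carrier (free_module K B)"
  shows "(\<lambda>b. v b \<oplus> w b) \<in> carrier (free_module K B)"
proof -
  have sub: "{b. v b \<oplus> w b \<noteq> \<zero>} \<subseteq> {b. v b \<noteq> \<zero>} \<union> {b. w b \<noteq> \<zero>}"
    using assms by (auto simp: carrier_free_module)
  have "finite ({b. v b \<noteq> \<zero>} \<union> {b. w b \<noteq> \<zero>})"
    using assms by (simp add: carrier_free_module)
  from finite_subset[OF sub this] show ?thesis
    using assms sub by (simp add: carrier_free_module) blast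
qed

lemma free_module_scale_closed:
  assumes "a \<in> carrier K" and "v \<in> carrier (free_module K B)"
  shows "(\<lambda>b. a \<otimes> v b) \<in> carrier (free_module K B)"
proof -
  have sub: "{b. a \<otimes> v b \<noteq> \<zero>} \<subseteq> {b. v b \<noteq> \<zero>}"
    using assms by (auto simp: carrier_free_module)
  have "finite {b. v b \<noteq> \<zero>}"
    using assms by (simp add: carrier_free_module)
  from finite_subset[OF sub this] show ?thesis
    using assms sub by (simp add: carrier_free_module) blast
qed

lemma module_free_module: "module K (free_module K B)"
proof (rule moduleI)
  show "abelian_group (free_module K B)"
  proof (rule abelian_groupI)
    fix x assume x: "x \<in> carrier (free_module K B)"
    have val: "x b \<in> carrier K" for b using x by (simp add: carrier_free_module)
    have "(\<lambda>b. \<ominus> \<one> \<otimes> x b) \<in> carrier (free_module K B)"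
      by (rule free_module_scale_closed) (use x in auto)
    moreover have "(\<lambda>b. \<ominus> \<one> \<otimes> x b) \<oplus>\<^bsub>free_module K B\<^esub> x = \<zero>\<^bsub>free_module K B\<^esub>"
      by (simp add: free_module_simps val l_minus l_neg)
    ultimately show "\<exists>y\<in>carrier (free_module K B). y \<oplus>\<^bsub>free_module K B\<^esub> x = \<zero>\<^bsub>free_module K B\<^esub>"
      by blast
  qed (simp_all add: free_module_simps free_module_plus_closed, simp_all add: carrier_free_module a_ac)
qed (simp_all add: free_module_simps free_module_scale_closed is_cring,
    simp_all add: carrier_free_module l_distr r_distr m_assoc)

lemma basis_vec_closed: "b \<in> B \<Longrightarrow> basis_vec K b \<in> carrier (free_module K B)"
  by (auto simp: carrier_free_module basis_vec_def intro: finite_subset[of _ "{b}"])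

lemma free_module_induct [consumes 1, case_names zero basis add scale]:
  assumes "v \<in> carrier (free_module K B)"
    and "Q \<zero>\<^bsub>free_module K B\<^esub>"
    and "\<And>b. b \<in> B \<Longrightarrow> Q (basis_vec K b)"
    and "\<And>v w. \<lbrakk>v \<in> carrier (free_module K B); w \<in> carrier (free_module K B); Q v; Q w\<rbrakk> \<Longrightarrow>
          Q (v \<oplus>\<^bsub>free_module K B\<^esub> w)"
    and "\<And>a v. \<lbrakk>a \<in> carrier K; v \<in> carrier (free_module K B); Q v\<rbrakk> \<Longrightarrow>
          Q (a \<odot>\<^bsub>free_module K B\<^esub> v)"
  shows "Q v"
  using assms(1)
proof (induction "card {b. v b \<noteq> \<zero>}" arbitrary: v rule: less_induct)
  case less
  show ?case
  proof (cases "{b. v b \<noteq> \<zero>} = {}")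
    case True
    then have "v = \<zero>\<^bsub>free_module K B\<^esub>" by (auto simp: free_module_simps fun_eq_iff)
    then show ?thesis using assms(2) by simp
  next
    case False
    then obtain b where b: "v b \<noteq> \<zero>" by blast
    have fin: "finite {b. v b \<noteq> \<zero>}" and bB: "b \<in> B" and vb: "v b \<in> carrier K"
      using less.prems b by (auto simp: carrier_free_module)
    define w where "w = v(b := \<zero>)"
    have supp: "{c. w c \<noteq> \<zero>} = {c. v c \<noteq> \<zero>} - {b}" by (auto simp: w_def)
    have w: "w \<in> carrier (free_module K B)"
      using less.prems unfolding carrier_free_module supp by (auto simp: w_def)
    have "card {c. w c \<noteq> \<zero>} < card {c. v c \<noteq> \<zero>}"
      unfolding supp using fin b by (intro psubset_card_mono) auto
    then have "Q w" using less.hyps w by blast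
    moreover have "v = w \<oplus>\<^bsub>free_module K B\<^esub> (v b \<odot>\<^bsub>free_module K B\<^esub> basis_vec K b)"
      using less.prems by (simp add: free_module_simps fun_eq_iff w_def basis_vec_def carrier_free_module)
    moreover have "v b \<odot>\<^bsub>free_module K B\<^esub> basis_vec K b \<in> carrier (free_module K B)"
      by (rule module.smult_closed[OF module_free_module vb basis_vec_closed[OF bB]])
    then have "Q (w \<oplus>\<^bsub>free_module K B\<^esub> (v b \<odot>\<^bsub>free_module K B\<^esub> basis_vec K b))"
      by (rule assms(4)[OF w _ \<open>Q w\<close> assms(5)[OF vb basis_vec_closed[OF bB] assms(3)[OF bB]]])
    ultimately show ?thesis by (simp only:)
  qed
qed

lemma linear_maps_zero:
  assumes "h \<in> linear_maps K A C" and "module K A" and "module K C"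
  shows "h \<zero>\<^bsub>A\<^esub> = \<zero>\<^bsub>C\<^esub>"
proof -
  interpret A: module K A by fact
  interpret C: module K C by fact
  have "h (\<zero> \<odot>\<^bsub>A\<^esub> \<zero>\<^bsub>A\<^esub>) = \<zero> \<odot>\<^bsub>C\<^esub> h \<zero>\<^bsub>A\<^esub>"
    by (rule linear_maps_smult[OF assms(1)]) auto
  then show ?thesis using linear_maps_closed[OF assms(1)] by simp
qed

lemma linear_maps_eqI:
  assumes A: "module K A"
    and h: "h \<in> linear_maps K (free_module K B) A" and g: "g \<in> linear_maps K (free_module K B) A"
    and eq: "\<And>b. b \<in> B \<Longrightarrow> h (basis_vec K b) = g (basis_vec K b)"
    and v: "v \<in> carrier (free_module K B)"
  shows "h v = g v"
  using v
proof (induction rule: free_module_induct)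
  case zero
  show ?case by (simp only: linear_maps_zero[OF h module_free_module A]
        linear_maps_zero[OF g module_free_module A])
next
  case (basis b)
  then show ?case by (rule eq)
next
  case (add v w)
  then show ?case by (simp only: linear_maps_add[OF h] linear_maps_add[OF g])
next
  case (scale a v)
  then show ?case by (simp only: linear_maps_smult[OF h] linear_maps_smult[OF g])
qed

text \<open>A linear extension formed in a large free module lands in the submodule spanned by fewer
  basis vectors as soon as its values on the basis do. This is how leaf counts are tracked below.\<close>

lemma linear_maps_into_subbasis:
  assumes h: "h \<in> linear_maps K (free_module K B) (free_module K C)"
    and basis: "\<And>b. b \<in> B \<Longrightarrow> h (basis_vec K b) \<in> carrier (free_module K C')"
  shows "h \<in> linear_maps K (free_module K B) (free_module K C')"
proof -
  interpret M: module K "free_module K C'" by (rule module_free_module)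
  have "h v \<in> carrier (free_module K C')" if "v \<in> carrier (free_module K B)" for v
    using that
  proof (induction rule: free_module_induct)
    case zero
    then show ?case
      using linear_maps_zero[OF h module_free_module module_free_module] M.zero_closed
      by (simp add: free_module_simps)
  next
    case (add v w)
    then show ?case
      using linear_maps_add[OF h add(1,2)] M.a_closed[OF add(3,4)] by (simp add: free_module_simps)
  next
    case (scale a v)
    then show ?case
      using linear_maps_smult[OF h scale(1,2)] M.smult_closed[OF scale(1,3)]
      by (simp add: free_module_simps)
  qed (rule basis)
  then show ?thesis using h by (auto simp: linear_maps_def free_module_simps)
qed

lemma bilinear_maps_eqI:
  assumes A: "module K A"
    and m: "m \<in> bilinear_maps K (free_module K B) (free_module K C) A"
    and n: "n \<in> bilinear_maps K (free_module K B) (free_module K C) A"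
    and eq: "\<And>b c. \<lbrakk>b \<in> B; c \<in> C\<rbrakk> \<Longrightarrow>
               m (basis_vec K b) (basis_vec K c) = n (basis_vec K b) (basis_vec K c)"
    and v: "v \<in> carrier (free_module K B)" and w: "w \<in> carrier (free_module K C)"
  shows "m v w = n v w"
proof (rule linear_maps_eqI[OF A bilinear_left[OF m w] bilinear_left[OF n w] _ v])
  fix b assume b: "b \<in> B"
  show "m (basis_vec K b) w = n (basis_vec K b) w"
    by (rule linear_maps_eqI[OF A bilinear_right[OF m basis_vec_closed[OF b]]
          bilinear_right[OF n basis_vec_closed[OF b]] eq[OF b] w])
qed

text \<open>The shape common to the associative law, \<open>(u \<squnion>\<^sub>x v) \<diamond> w = u \<squnion>\<^sub>x (v \<diamond> w)\<close> and its mirror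
  image.\<close>

lemma trilinear_law_from_basis:
  fixes B :: "'c set"
  defines "M \<equiv> free_module K B"
  assumes m: "m \<in> bilinear_maps K M M M" and n: "n \<in> bilinear_maps K M M M"
    and m': "m' \<in> bilinear_maps K M M M" and n': "n' \<in> bilinear_maps K M M M"
    and eq: "\<And>b c d. \<lbrakk>b \<in> B; c \<in> B; d \<in> B\<rbrakk> \<Longrightarrow>
        m (n (basis_vec K b) (basis_vec K c)) (basis_vec K d) =
        m' (basis_vec K b) (n' (basis_vec K c) (basis_vec K d))"
    and u: "u \<in> carrier M" and v: "v \<in> carrier M" and w: "w \<in> carrier M"
  shows "m (n u v) w = m' u (n' v w)"
proof -
  have M: "module K M" unfolding M_def by (rule module_free_module)
  have basis: "m (n (basis_vec K b) v) w = m' (basis_vec K b) (n' v w)" if b: "b \<in> B" for b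
  proof -
    have bM: "basis_vec K b \<in> carrier M" unfolding M_def by (rule basis_vec_closed[OF b])
    have l: "(\<lambda>v w. m (n (basis_vec K b) v) w) \<in> bilinear_maps K M M M"
      using bilinear_maps_compose[OF m bilinear_right[OF n bM] linear_maps_ident linear_maps_ident] .
    have r: "(\<lambda>v w. m' (basis_vec K b) (n' v w)) \<in> bilinear_maps K M M M"
      using bilinear_maps_compose[OF n' linear_maps_ident linear_maps_ident bilinear_right[OF m' bM]] .
    show ?thesis
      using bilinear_maps_eqI[OF M[unfolded M_def] l[unfolded M_def] r[unfolded M_def]
          eq[OF b] v[unfolded M_def] w[unfolded M_def]] .
  qed
  have "(\<lambda>u. m (n u v) w) \<in> linear_maps K M M"
    by (rule linear_maps_compose[OF bilinear_left[OF n v] bilinear_left[OF m w]])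
  moreover have "(\<lambda>u. m' u (n' v w)) \<in> linear_maps K M M"
    by (rule bilinear_left[OF m' bilinear_closed[OF n' v w]])
  ultimately show ?thesis
    using linear_maps_eqI[of M "\<lambda>u. m (n u v) w" B "\<lambda>u. m' u (n' v w)" u] M basis u
    unfolding M_def by blast
qed

text \<open>The sum defining \<^const>\<open>lin_ext\<close> ranges over a support that changes with the vector; adding
  two vectors requires a common index set.\<close>

lemma lin_ext_superset:
  assumes A: "module K A" and g: "g \<in> S \<rightarrow> carrier A" and S: "finite S" "{b. v b \<noteq> \<zero>} \<subseteq> S"
    and v: "\<And>b. v b \<in> carrier K"
  shows "lin_ext K A g v = (\<Oplus>\<^bsub>A\<^esub>b\<in>S. v b \<odot>\<^bsub>A\<^esub> g b)"
proof -
  interpret A: module K A by fact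
  show ?thesis
    unfolding lin_ext_def
    by (rule A.M.add.finprod_mono_neutral_cong_left) (use assms in \<open>auto simp: Pi_iff\<close>)
qed

lemma lin_ext_linear:
  assumes A: "module K A" and g: "g \<in> B \<rightarrow> carrier A"
  shows "lin_ext K A g \<in> linear_maps K (free_module K B) A"
proof -
  interpret A: module K A by fact
  interpret M: module K "free_module K B" by (rule module_free_module)
  have dest: "v b \<in> carrier K" "{b. v b \<noteq> \<zero>} \<subseteq> B" "finite {b. v b \<noteq> \<zero>}"
    if "v \<in> carrier (free_module K B)" for v b
    using that by (auto simp: carrier_free_module)
  show ?thesis
  proof (rule linear_mapsI)
    fix v w assume v: "v \<in> carrier (free_module K B)" and w: "w \<in> carrier (free_module K B)"
    let ?S = "{b. v b \<noteq> \<zero>} \<union> {b. w b \<noteq> \<zero>}"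
    have gS: "g \<in> ?S \<rightarrow> carrier A" using g dest(2)[OF v] dest(2)[OF w] by blast
    have S: "finite ?S" using dest(3)[OF v] dest(3)[OF w] by blast
    have "lin_ext K A g (\<lambda>b. v b \<oplus> w b) = (\<Oplus>\<^bsub>A\<^esub>b\<in>?S. (v b \<oplus> w b) \<odot>\<^bsub>A\<^esub> g b)"
      by (rule lin_ext_superset[OF A gS S]) (use dest[OF v] dest[OF w] in auto)
    also have "\<dots> = (\<Oplus>\<^bsub>A\<^esub>b\<in>?S. v b \<odot>\<^bsub>A\<^esub> g b \<oplus>\<^bsub>A\<^esub> w b \<odot>\<^bsub>A\<^esub> g b)"
      by (rule A.M.finsum_cong')
        (use gS dest(1)[OF v] dest(1)[OF w] in \<open>auto simp: Pi_iff A.smult_l_distr\<close>)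
    also have "\<dots> = (\<Oplus>\<^bsub>A\<^esub>b\<in>?S. v b \<odot>\<^bsub>A\<^esub> g b) \<oplus>\<^bsub>A\<^esub> (\<Oplus>\<^bsub>A\<^esub>b\<in>?S. w b \<odot>\<^bsub>A\<^esub> g b)"
      by (rule A.M.finsum_addf) (use gS dest(1)[OF v] dest(1)[OF w] in \<open>auto simp: Pi_iff\<close>)
    also have "\<dots> = lin_ext K A g v \<oplus>\<^bsub>A\<^esub> lin_ext K A g w"
      by (subst (1 2) lin_ext_superset[OF A gS S]) (use dest(1)[OF v] dest(1)[OF w] in auto)
    finally show "lin_ext K A g (v \<oplus>\<^bsub>free_module K B\<^esub> w) =
      lin_ext K A g v \<oplus>\<^bsub>A\<^esub> lin_ext K A g w" by (simp add: free_module_simps)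
  next
    fix a v assume a: "a \<in> carrier K" and v: "v \<in> carrier (free_module K B)"
    let ?S = "{b. v b \<noteq> \<zero>}"
    have gS: "g \<in> ?S \<rightarrow> carrier A" using g dest(2)[OF v] by blast
    have "lin_ext K A g (\<lambda>b. a \<otimes> v b) = (\<Oplus>\<^bsub>A\<^esub>b\<in>?S. (a \<otimes> v b) \<odot>\<^bsub>A\<^esub> g b)"
      by (rule lin_ext_superset[OF A gS dest(3)[OF v]]) (use a dest[OF v] in auto)
    also have "\<dots> = (\<Oplus>\<^bsub>A\<^esub>b\<in>?S. a \<odot>\<^bsub>A\<^esub> (v b \<odot>\<^bsub>A\<^esub> g b))"
      by (rule A.M.finsum_cong')
        (use a gS dest(1)[OF v] in \<open>auto simp: Pi_iff A.smult_assoc1\<close>)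
    also have "\<dots> = a \<odot>\<^bsub>A\<^esub> lin_ext K A g v"
      unfolding lin_ext_def
      by (rule A.finsum_smult_ldistr[symmetric, OF dest(3)[OF v] a])
        (use gS dest(1)[OF v] in \<open>auto simp: Pi_iff\<close>)
    finally show "lin_ext K A g (a \<odot>\<^bsub>free_module K B\<^esub> v) = a \<odot>\<^bsub>A\<^esub> lin_ext K A g v"
      by (simp add: free_module_simps)
  next
    fix v assume v: "v \<in> carrier (free_module K B)"
    show "lin_ext K A g v \<in> carrier A"
      unfolding lin_ext_def
      by (rule A.M.finsum_closed) (use g dest[OF v] in \<open>auto simp: Pi_iff\<close>)
  qed
qed

lemma lin_ext_basis:
  assumes A: "module K A" and g: "g b \<in> carrier A"
  shows "lin_ext K A g (basis_vec K b) = g b"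
proof -
  interpret A: module K A by fact
  have "lin_ext K A g (basis_vec K b) = (\<Oplus>\<^bsub>A\<^esub>c\<in>{b}. basis_vec K b c \<odot>\<^bsub>A\<^esub> g c)"
    by (rule lin_ext_superset[OF A]) (use g in \<open>auto simp: basis_vec_def split: if_splits\<close>)
  then show ?thesis using g by (simp add: basis_vec_def)
qed

text \<open>Linearity of \<^const>\<open>lin_ext\<close> in the family that is extended, as opposed to its
  argument. This is what makes \<^const>\<open>bilin_ext\<close> linear in its second argument.\<close>

lemma lin_ext_coeff_linear:
  assumes A: "module K A" and C: "module K C" and v: "v \<in> carrier (free_module K B)"
    and g: "\<And>b. b \<in> B \<Longrightarrow> (\<lambda>w. g w b) \<in> linear_maps K C A"
  shows "(\<lambda>w. lin_ext K A (g w) v) \<in> linear_maps K C A"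
proof -
  interpret A: module K A by fact
  interpret C: module K C by fact
  have lin: "lin_ext K A (g w) \<in> linear_maps K (free_module K B) A" if "w \<in> carrier C" for w
    by (rule lin_ext_linear[OF A]) (use linear_maps_closed[OF g] that in auto)
  show ?thesis
  proof (rule linear_mapsI)
    fix w assume w: "w \<in> carrier C"
    then show "lin_ext K A (g w) v \<in> carrier A" using linear_maps_closed[OF lin] v by blast
  next
    fix w w' assume w: "w \<in> carrier C" and w': "w' \<in> carrier C"
    show "lin_ext K A (g (w \<oplus>\<^bsub>C\<^esub> w')) v = lin_ext K A (g w) v \<oplus>\<^bsub>A\<^esub> lin_ext K A (g w') v"
      by (rule linear_maps_eqI[OF A lin linear_maps_plus[OF A lin lin] _ v])
        (use w w' in \<open>auto simp: lin_ext_basis[OF A] linear_mapsD[OF g]\<close>)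
  next
    fix a w assume a: "a \<in> carrier K" and w: "w \<in> carrier C"
    show "lin_ext K A (g (a \<odot>\<^bsub>C\<^esub> w)) v = a \<odot>\<^bsub>A\<^esub> lin_ext K A (g w) v"
      by (rule linear_maps_eqI[OF A lin linear_maps_scale[OF A lin] _ v])
        (use a w in \<open>auto simp: lin_ext_basis[OF A] linear_mapsD[OF g]\<close>)
  qed
qed

lemma bilin_ext_bilinear:
  assumes A: "module K A" and g: "\<And>b c. \<lbrakk>b \<in> B; c \<in> C\<rbrakk> \<Longrightarrow> g b c \<in> carrier A"
  shows "bilin_ext K A g \<in> bilinear_maps K (free_module K B) (free_module K C) A"
proof -
  have lin: "lin_ext K A (g b) \<in> linear_maps K (free_module K C) A" if "b \<in> B" for b
    by (rule lin_ext_linear[OF A]) (use g that in blast)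
  have "(\<lambda>v. bilin_ext K A g v w) \<in> linear_maps K (free_module K B) A"
    if "w \<in> carrier (free_module K C)" for w
    unfolding bilin_ext_def
    by (rule lin_ext_linear[OF A]) (use linear_maps_closed[OF lin that] in blast)
  moreover have "bilin_ext K A g v \<in> linear_maps K (free_module K C) A"
    if "v \<in> carrier (free_module K B)" for v
    unfolding bilin_ext_def
    by (rule lin_ext_coeff_linear[OF A module_free_module that lin])
  ultimately show ?thesis by (simp add: bilinear_maps_def)
qed

lemma bilin_ext_basis:
  assumes "module K A" and "g b c \<in> carrier A"
  shows "bilin_ext K A g (basis_vec K b) (basis_vec K c) = g b c"
  using assms by (simp add: bilin_ext_def lin_ext_basis)

end

section \<open>Products of forests\<close>

text \<open>Decorating a combination of forests with one tuple makes sense only when all of them have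
  the same number of leaves, so all linear maps on forests are graded by this number.\<close>

definition forests_with_leaves :: "nat \<Rightarrow> pforest set"
  where "forests_with_leaves n = {F \<in> forests. leaves F = n}"

lemma forests_with_leaves_subset: "forests_with_leaves n \<subseteq> forests"
  by (auto simp: forests_with_leaves_def)

lemma leaves_simps [simp]:
  "leaves [] = 0" "leaves (T # F) = tree_leaves T + leaves F" "leaves (F @ G) = leaves F + leaves G"
  by (simp_all add: leaves_def)

lemma tree_leaves_Node [simp]: "tree_leaves (Node F) = (if F = [] then 1 else leaves F)"
  by (simp add: leaves_def)

declare tree_leaves.simps [simp del]

lemma tree_leaves_pos: "tree_leaves T \<ge> 1"
proof (induction T)
  case (Node F)
  then show ?case by (cases F) (auto intro: trans_le_add1)
qed

lemma leaves_pos: "F \<noteq> [] \<Longrightarrow> leaves F \<ge> 1"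
  using tree_leaves_pos by (cases F) (auto intro: trans_le_add1)

context coefficient_ring
begin

lemma graft_lin_linear:
  "graft_lin K \<in> linear_maps K (free_module K (forests_with_leaves n))
                    (free_module K (forests_with_leaves n))"
proof (rule linear_maps_into_subbasis)
  show lin: "graft_lin K \<in> linear_maps K (free_module K (forests_with_leaves n)) (forest_module K)"
    unfolding graft_lin_def
    by (rule linear_maps_subbasis[OF lin_ext_linear[OF module_free_module] forests_with_leaves_subset])
      (auto intro: basis_vec_closed simp: forests_def)
  show "graft_lin K (basis_vec K F) \<in> carrier (free_module K (forests_with_leaves n))"
    if "F \<in> forests_with_leaves n" for F
    unfolding graft_lin_def
    by (subst lin_ext_basis[OF module_free_module])
      (use that in \<open>auto intro!: basis_vec_closed simp: forests_def forests_with_leaves_def\<close>)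
qed

lemma graft_lin_basis: "graft_lin K (basis_vec K F) = basis_vec K [Node F]"
  unfolding graft_lin_def
  by (rule lin_ext_basis[OF module_free_module]) (auto intro: basis_vec_closed simp: forests_def)

lemma concat_lin_basis:
  assumes "F \<noteq> []"
  shows "concat_lin K A (basis_vec K F) C = basis_vec K (A @ F @ C)"
  unfolding concat_lin_def
  by (rule lin_ext_basis[OF module_free_module])
    (use assms in \<open>auto intro: basis_vec_closed simp: forests_def\<close>)

lemma concat_lin_linear:
  "(\<lambda>v. concat_lin K A v C) \<in> linear_maps K (free_module K (forests_with_leaves n))
      (free_module K (forests_with_leaves (leaves A + n + leaves C)))"
proof (rule linear_maps_into_subbasis)
  show lin: "(\<lambda>v. concat_lin K A v C) \<in>
    linear_maps K (free_module K (forests_with_leaves n)) (forest_module K)"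
    unfolding concat_lin_def
    by (rule linear_maps_subbasis[OF lin_ext_linear[OF module_free_module] forests_with_leaves_subset])
      (auto intro: basis_vec_closed simp: forests_def)
  show "concat_lin K A (basis_vec K F) C \<in>
      carrier (free_module K (forests_with_leaves (leaves A + n + leaves C)))"
    if "F \<in> forests_with_leaves n" for F
    by (subst concat_lin_basis)
      (use that in \<open>auto intro!: basis_vec_closed simp: forests_def forests_with_leaves_def\<close>)
qed

lemma concat_lin_concat_lin:
  assumes v: "v \<in> carrier (free_module K (forests_with_leaves n))"
  shows "concat_lin K A (concat_lin K A' v C') C = concat_lin K (A @ A') v (C' @ C)"
proof (rule linear_maps_eqI[OF module_free_module _ _ _ v])
  show "(\<lambda>v. concat_lin K A (concat_lin K A' v C') C) \<in>
      linear_maps K (free_module K (forests_with_leaves n))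
        (free_module K (forests_with_leaves (leaves A + (leaves A' + n + leaves C') + leaves C)))"
    by (rule linear_maps_compose[OF concat_lin_linear concat_lin_linear])
  show "(\<lambda>v. concat_lin K (A @ A') v (C' @ C)) \<in>
      linear_maps K (free_module K (forests_with_leaves n))
        (free_module K (forests_with_leaves (leaves A + (leaves A' + n + leaves C') + leaves C)))"
    using concat_lin_linear[of "A @ A'" "C' @ C" n] by (simp add: ac_simps)
  show "concat_lin K A (concat_lin K A' (basis_vec K F) C') C =
      concat_lin K (A @ A') (basis_vec K F) (C' @ C)" if "F \<in> forests_with_leaves n" for F
    using that by (simp add: forests_with_leaves_def forests_def concat_lin_basis)
qed

lemma concat_lin_Nil:
  assumes v: "v \<in> carrier (free_module K (forests_with_leaves n))"
  shows "concat_lin K [] v [] = v"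
proof (rule linear_maps_eqI[OF module_free_module _ linear_maps_ident _ v])
  show "(\<lambda>v. concat_lin K [] v []) \<in>
      linear_maps K (free_module K (forests_with_leaves n)) (free_module K (forests_with_leaves n))"
    using concat_lin_linear[of "[]" "[]" n] by simp
  show "concat_lin K [] (basis_vec K F) [] = basis_vec K F" if "F \<in> forests_with_leaves n" for F
    using that by (simp add: forests_with_leaves_def forests_def concat_lin_basis)
qed

end

text \<open>A product fuses the last leaf of the left factor with the first leaf of the right one, so
  one leaf is lost; grafting changes no leaf count, since the new root is not a leaf.\<close>

lemma
  assumes "cring K" and "lam \<in> carrier K"
  shows tree_prod_closed: "tree_prod K lam T T' \<in>
      carrier (free_module K (forests_with_leaves (tree_leaves T + tree_leaves T' - 1)))" (is ?t)
    and forest_prod_closed: "\<lbrakk>F \<noteq> []; F' \<noteq> []\<rbrakk> \<Longrightarrow> forest_prod K lam F F' \<in>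
      carrier (free_module K (forests_with_leaves (leaves F + leaves F' - 1)))" (is "_ \<Longrightarrow> _ \<Longrightarrow> ?f")
proof -
  have "cring K \<Longrightarrow> lam \<in> carrier K \<Longrightarrow> ?t"
    and "cring K \<Longrightarrow> lam \<in> carrier K \<Longrightarrow> F \<noteq> [] \<Longrightarrow> F' \<noteq> [] \<Longrightarrow> ?f"
  proof (induction K lam T T' and K lam F F' rule: tree_prod_forest_prod.induct)
    case (1 K lam T T')
    interpret coefficient_ring K using 1(4) by (rule coefficient_ring.intro)
    obtain F F' where TT: "T = Node F" "T' = Node F'" by (metis ptree.exhaust)
    let ?M = "free_module K (forests_with_leaves (tree_leaves T + tree_leaves T' - 1))"
    interpret M: module K ?M by (rule module_free_module)
    consider "F' = []" | "F' \<noteq> []" "F = []" | "F' \<noteq> []" "F \<noteq> []" by blast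
    then show ?case
    proof cases
      case 3
      have lin: "graft_lin K \<in> linear_maps K ?M ?M" by (rule graft_lin_linear)
      have "graft_lin K (forest_prod K lam [T] F') \<in> carrier ?M"
        "graft_lin K (forest_prod K lam F [T']) \<in> carrier ?M"
        "graft_lin K (forest_prod K lam F F') \<in> carrier ?M"
        using 1(1,2,3)[OF _ _ 1(4,5)] linear_maps_closed[OF lin] TT 3 by auto
      then have "graft_lin K (forest_prod K lam [T] F') \<oplus>\<^bsub>?M\<^esub> graft_lin K (forest_prod K lam F [T'])
          \<oplus>\<^bsub>?M\<^esub> lam \<odot>\<^bsub>?M\<^esub> graft_lin K (forest_prod K lam F F') \<in> carrier ?M"
        using 1(5) by (intro M.M.a_closed M.smult_closed)
      then show ?thesis using TT 3 by (simp add: tree_prod.simps free_module_simps)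
    qed (auto simp: TT tree_prod.simps forests_with_leaves_def forests_def leaves_pos
          intro!: basis_vec_closed)
  next
    case (2 K lam F F')
    interpret coefficient_ring K using 2(2) by (rule coefficient_ring.intro)
    obtain A T where F: "F = A @ [T]" using 2(4) by (cases F rule: rev_cases) blast
    obtain T' C where F': "F' = T' # C" using 2(5) by (cases F') blast
    have "leaves A + (tree_leaves T + tree_leaves T' - 1) + leaves C = leaves F + leaves F' - 1"
      using tree_leaves_pos[of T] by (simp add: F F')
    then show ?case
      using linear_maps_closed[OF concat_lin_linear 2(1)[OF _ 2(2,3)], of A C]
      by (subst forest_prod.simps) (simp add: F F')
  qed
  then show ?t and "\<lbrakk>F \<noteq> []; F' \<noteq> []\<rbrakk> \<Longrightarrow> ?f" using assms by auto
qed

locale weighted_ring = coefficient_ring +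
  fixes lam
  assumes lam [simp]: "lam \<in> carrier K"
begin

lemmas tree_prod_carrier = tree_prod_closed[OF is_cring lam]
lemmas forest_prod_carrier = forest_prod_closed[OF is_cring lam]

lemma forest_prod_trees: "forest_prod K lam [T] [T'] = tree_prod K lam T T'"
  by (simp add: forest_prod.simps concat_lin_Nil[OF tree_prod_carrier])

text \<open>The product changes only the last tree of the left factor and the first tree of the right
  one, so trees further out can be split off.\<close>

lemma forest_prod_concat_left:
  assumes "F \<noteq> []" and "F' \<noteq> []"
  shows "forest_prod K lam (A @ F) F' = concat_lin K A (forest_prod K lam F F') []"
  using assms
  by (simp add: forest_prod.simps butlast_append concat_lin_concat_lin[OF tree_prod_carrier])

lemma forest_prod_concat_right:
  assumes "F \<noteq> []" and "F' \<noteq> []"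
  shows "forest_prod K lam F (F' @ C) = concat_lin K [] (forest_prod K lam F F') C"
  using assms
  by (simp add: forest_prod.simps concat_lin_concat_lin[OF tree_prod_carrier])

lemma forest_prod_bullet_left:
  assumes "F \<noteq> []"
  shows "forest_prod K lam [bullet] F = basis_vec K F"
  using assms by (cases F) (auto simp: forest_prod.simps tree_prod.simps concat_lin_basis)

lemma forest_prod_bullet_right:
  assumes "F \<noteq> []"
  shows "forest_prod K lam F [bullet] = basis_vec K F"
  using assms by (auto simp: forest_prod.simps tree_prod.simps concat_lin_basis)

end

section \<open>Decorated forests\<close>

abbreviation decorated_module ::
    "('k, 'm) ring_scheme \<Rightarrow> 'x set \<Rightarrow> ('k, 'x dforest \<Rightarrow> 'k) module"
  where "decorated_module K X \<equiv> free_module K (decorated_forests X)"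

definition graft_dforest :: "'x dforest \<Rightarrow> 'x dforest"
  where "graft_dforest D = ([Node (fst D)], snd D)"

text \<open>The operation \<open>\<squnion>\<^sub>x\<close>: \<open>x\<close> decorates the angle where the two forests meet.\<close>

definition join_dforest :: "'x \<Rightarrow> 'x dforest \<Rightarrow> 'x dforest \<Rightarrow> 'x dforest"
  where "join_dforest x D E = (fst D @ fst E, snd D @ x # snd E)"

definition join_prod ::
    "('k, 'm) ring_scheme \<Rightarrow> 'x set \<Rightarrow> 'x \<Rightarrow> ('x dforest \<Rightarrow> 'k) \<Rightarrow> ('x dforest \<Rightarrow> 'k) \<Rightarrow>
     ('x dforest \<Rightarrow> 'k)"
  where "join_prod K X x =
    bilin_ext K (decorated_module K X) (\<lambda>D E. basis_vec K (join_dforest x D E))"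

text \<open>Nonempty forests have a leaf, so the truncated difference in \<^const>\<open>decorated_forests\<close> can
  be replaced by a sum.\<close>

lemma in_decorated_forests:
  "(F, xs) \<in> decorated_forests X \<longleftrightarrow> F \<noteq> [] \<and> set xs \<subseteq> X \<and> length xs + 1 = leaves F"
  using leaves_pos[of F] by (auto simp: decorated_forests_def forests_def)

lemma unit_in_decorated_forests: "([bullet], []) \<in> decorated_forests X"
  by (simp add: in_decorated_forests)

lemma graft_in_decorated_forests:
  "D \<in> decorated_forests X \<Longrightarrow> graft_dforest D \<in> decorated_forests X"
  by (cases D) (auto simp: in_decorated_forests graft_dforest_def)

lemma join_in_decorated_forests:
  "\<lbrakk>D \<in> decorated_forests X; E \<in> decorated_forests X; x \<in> X\<rbrakk> \<Longrightarrow>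
   join_dforest x D E \<in> decorated_forests X"
  by (cases D; cases E) (auto simp: in_decorated_forests join_dforest_def)

definition dforest_size :: "'x dforest \<Rightarrow> nat"
  where "dforest_size D = size_list size (fst D)"

lemma dforest_size_graft: "dforest_size D < dforest_size (graft_dforest D)"
  by (simp add: dforest_size_def graft_dforest_def)

lemma dforest_size_pos: "D \<in> decorated_forests X \<Longrightarrow> 0 < dforest_size D"
  by (cases D; cases "fst D") (auto simp: in_decorated_forests dforest_size_def)

lemma dforest_size_join:
  assumes "D \<in> decorated_forests X" and "E \<in> decorated_forests X"
  shows "dforest_size D < dforest_size (join_dforest x D E)"
    and "dforest_size E < dforest_size (join_dforest x D E)"
  using dforest_size_pos[OF assms(1)] dforest_size_pos[OF assms(2)]
  by (auto simp: dforest_size_def join_dforest_def)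

text \<open>A forest with at least two trees is split after its first tree; if that tree has \<open>k + 1\<close>
  leaves, it takes the first \<open>k\<close> decorations, and the next one belongs to the angle at the cut.\<close>

lemma decorated_forest_cases:
  assumes "D \<in> decorated_forests X"
  obtains (unit) "D = ([bullet], [])"
    | (graft) E where "E \<in> decorated_forests X" "D = graft_dforest E"
    | (join) E G x where "E \<in> decorated_forests X" "G \<in> decorated_forests X" "x \<in> X"
        "D = join_dforest x E G"
proof -
  obtain F xs where D: "D = (F, xs)" by (cases D)
  have dec: "F \<noteq> []" "set xs \<subseteq> X" "length xs + 1 = leaves F"
    using assms by (auto simp: D in_decorated_forests)
  obtain T G where F: "F = T # G" using dec(1) by (cases F) auto
  show thesis
  proof (cases "G = []")
    case True
    obtain F' where T: "T = Node F'" by (cases T)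
    show thesis
    proof (cases "F' = []")
      case True
      then show thesis using dec \<open>G = []\<close> by (intro unit) (auto simp: D F T)
    next
      case False
      then show thesis
        using dec \<open>G = []\<close>
        by (intro graft[of "(F', xs)"]) (auto simp: D F T in_decorated_forests graft_dforest_def)
    qed
  next
    case False
    define k where "k = tree_leaves T - 1"
    have k: "k < length xs" "tree_leaves T = k + 1" "length xs - k = leaves G"
      using dec(3) tree_leaves_pos[of T] leaves_pos[OF False] by (auto simp: k_def F)
    have xs: "xs = take k xs @ xs ! k # drop (Suc k) xs" using k by (simp add: id_take_nth_drop)
    show thesis
    proof (rule join[of "([T], take k xs)" "(G, drop (Suc k) xs)" "xs ! k"])
      show "([T], take k xs) \<in> decorated_forests X" "(G, drop (Suc k) xs) \<in> decorated_forests X"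
        "xs ! k \<in> X"
        using k dec(2) False set_take_subset[of k xs] set_drop_subset[of "Suc k" xs]
        by (auto simp: in_decorated_forests)
      show "D = join_dforest (xs ! k) ([T], take k xs) (G, drop (Suc k) xs)"
        using xs by (simp add: join_dforest_def D F)
    qed
  qed
qed

lemma decorated_forest_induct [consumes 1, case_names unit graft join]:
  assumes "D \<in> decorated_forests X"
    and "Q ([bullet], [])"
    and "\<And>D. \<lbrakk>D \<in> decorated_forests X; Q D\<rbrakk> \<Longrightarrow> Q (graft_dforest D)"
    and "\<And>D E x. \<lbrakk>D \<in> decorated_forests X; E \<in> decorated_forests X; x \<in> X; Q D; Q E\<rbrakk> \<Longrightarrow>
           Q (join_dforest x D E)"
  shows "Q D"
  using assms(1)
proof (induction "dforest_size D" arbitrary: D rule: less_induct)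
  case less
  from less.prems show ?case
  proof (cases rule: decorated_forest_cases)
    case unit
    then show ?thesis using assms(2) by simp
  next
    case (graft E)
    then show ?thesis using assms(3)[of E] less.hyps[of E] dforest_size_graft[of E] by simp
  next
    case (join E G x)
    then show ?thesis
      using assms(4)[of E G x] less.hyps[of E] less.hyps[of G] dforest_size_join[of E X G x] by simp
  qed
qed

context coefficient_ring
begin

lemma ShNC_op_linear: "ShNC_op K X \<in> linear_maps K (decorated_module K X) (decorated_module K X)"
  unfolding ShNC_op_def
  by (rule lin_ext_linear[OF module_free_module])
    (auto intro!: basis_vec_closed simp: in_decorated_forests)

lemma ShNC_op_basis:
  assumes "D \<in> decorated_forests X"
  shows "ShNC_op K X (basis_vec K D) = basis_vec K (graft_dforest D)"
  unfolding ShNC_op_def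
  using lin_ext_basis[OF module_free_module, of "\<lambda>(F, xs). basis_vec K ([Node F], xs)" D]
    basis_vec_closed[OF graft_in_decorated_forests[OF assms]]
  by (simp add: graft_dforest_def case_prod_unfold)

lemma join_prod_bilinear:
  assumes "x \<in> X"
  shows "join_prod K X x \<in>
    bilinear_maps K (decorated_module K X) (decorated_module K X) (decorated_module K X)"
  unfolding join_prod_def
  by (rule bilin_ext_bilinear[OF module_free_module])
    (use assms in \<open>auto intro!: basis_vec_closed join_in_decorated_forests\<close>)

lemma join_prod_basis:
  assumes "x \<in> X" and "D \<in> decorated_forests X" and "E \<in> decorated_forests X"
  shows "join_prod K X x (basis_vec K D) (basis_vec K E) = basis_vec K (join_dforest x D E)"
  unfolding join_prod_def
  by (rule bilin_ext_basis[OF module_free_module])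
    (use assms in \<open>auto intro!: basis_vec_closed join_in_decorated_forests\<close>)

text \<open>The codomain explains the restriction to a fixed number of leaves: with a tuple of the
  wrong length the pairs would not be decorated forests.\<close>

lemma decorate_linear:
  assumes "set xs \<subseteq> X" and "length xs + 1 = n"
  shows "(\<lambda>v. decorate K X v xs) \<in>
    linear_maps K (free_module K (forests_with_leaves n)) (decorated_module K X)"
  unfolding decorate_def
  by (rule lin_ext_linear[OF module_free_module])
    (use assms in \<open>auto intro!: basis_vec_closed simp: in_decorated_forests forests_with_leaves_def
       forests_def\<close>)

lemma decorate_basis:
  assumes "(F, xs) \<in> decorated_forests X"
  shows "decorate K X (basis_vec K F) xs = basis_vec K (F, xs)"
  unfolding decorate_def
  using lin_ext_basis[OF module_free_module, of "\<lambda>F. basis_vec K (F, xs)" F]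
    basis_vec_closed[OF assms] by blast

lemma decorate_graft:
  assumes v: "v \<in> carrier (free_module K (forests_with_leaves n))"
    and xs: "set xs \<subseteq> X" "length xs + 1 = n"
  shows "decorate K X (graft_lin K v) xs = ShNC_op K X (decorate K X v xs)"
proof (rule linear_maps_eqI[OF module_free_module _ _ _ v])
  show "(\<lambda>v. decorate K X (graft_lin K v) xs) \<in>
      linear_maps K (free_module K (forests_with_leaves n)) (decorated_module K X)"
    by (rule linear_maps_compose[OF graft_lin_linear decorate_linear[OF xs]])
  show "(\<lambda>v. ShNC_op K X (decorate K X v xs)) \<in>
      linear_maps K (free_module K (forests_with_leaves n)) (decorated_module K X)"
    by (rule linear_maps_compose[OF decorate_linear[OF xs] ShNC_op_linear])
  show "decorate K X (graft_lin K (basis_vec K F)) xs = ShNC_op K X (decorate K X (basis_vec K F) xs)"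
    if "F \<in> forests_with_leaves n" for F
  proof -
    have D: "(F, xs) \<in> decorated_forests X"
      using that xs by (auto simp: in_decorated_forests forests_with_leaves_def forests_def)
    then show ?thesis
      using graft_in_decorated_forests[OF D]
      by (simp add: graft_lin_basis decorate_basis ShNC_op_basis graft_dforest_def)
  qed
qed

text \<open>Concatenating a fixed forest is a join once everything is decorated. These two lemmas and
  \<open>decorate_graft\<close> carry the recursion from plain to decorated forests.\<close>

lemma decorate_concat_left:
  assumes D: "(A, ys) \<in> decorated_forests X" and x: "x \<in> X"
    and v: "v \<in> carrier (free_module K (forests_with_leaves n))"
    and xs: "set xs \<subseteq> X" "length xs + 1 = n"
  shows "decorate K X (concat_lin K A v []) (ys @ x # xs) =
    join_prod K X x (basis_vec K (A, ys)) (decorate K X v xs)"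
proof (rule linear_maps_eqI[OF module_free_module _ _ _ v])
  have len: "set (ys @ x # xs) \<subseteq> X" "length (ys @ x # xs) + 1 = leaves A + n + leaves []"
    using D x xs by (auto simp: in_decorated_forests)
  show "(\<lambda>v. decorate K X (concat_lin K A v []) (ys @ x # xs)) \<in>
      linear_maps K (free_module K (forests_with_leaves n)) (decorated_module K X)"
    by (rule linear_maps_compose[OF concat_lin_linear decorate_linear[OF len]])
  show "(\<lambda>v. join_prod K X x (basis_vec K (A, ys)) (decorate K X v xs)) \<in>
      linear_maps K (free_module K (forests_with_leaves n)) (decorated_module K X)"
    by (rule linear_maps_compose[OF decorate_linear[OF xs]
          bilinear_right[OF join_prod_bilinear[OF x] basis_vec_closed[OF D]]])
  show "decorate K X (concat_lin K A (basis_vec K F) []) (ys @ x # xs) =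
      join_prod K X x (basis_vec K (A, ys)) (decorate K X (basis_vec K F) xs)"
    if "F \<in> forests_with_leaves n" for F
  proof -
    have E: "(F, xs) \<in> decorated_forests X" and "F \<noteq> []"
      using that xs by (auto simp: in_decorated_forests forests_with_leaves_def forests_def)
    then show ?thesis
      using join_in_decorated_forests[OF D E x]
      by (simp add: concat_lin_basis decorate_basis join_prod_basis[OF x D] join_dforest_def)
  qed
qed

lemma decorate_concat_right:
  assumes D: "(C, ys) \<in> decorated_forests X" and x: "x \<in> X"
    and v: "v \<in> carrier (free_module K (forests_with_leaves n))"
    and xs: "set xs \<subseteq> X" "length xs + 1 = n"
  shows "decorate K X (concat_lin K [] v C) (xs @ x # ys) =
    join_prod K X x (decorate K X v xs) (basis_vec K (C, ys))"
proof (rule linear_maps_eqI[OF module_free_module _ _ _ v])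
  have len: "set (xs @ x # ys) \<subseteq> X" "length (xs @ x # ys) + 1 = leaves [] + n + leaves C"
    using D x xs by (auto simp: in_decorated_forests)
  show "(\<lambda>v. decorate K X (concat_lin K [] v C) (xs @ x # ys)) \<in>
      linear_maps K (free_module K (forests_with_leaves n)) (decorated_module K X)"
    by (rule linear_maps_compose[OF concat_lin_linear decorate_linear[OF len]])
  show "(\<lambda>v. join_prod K X x (decorate K X v xs) (basis_vec K (C, ys))) \<in>
      linear_maps K (free_module K (forests_with_leaves n)) (decorated_module K X)"
    by (rule linear_maps_compose[OF decorate_linear[OF xs]
          bilinear_left[OF join_prod_bilinear[OF x] basis_vec_closed[OF D]]])
  show "decorate K X (concat_lin K [] (basis_vec K F) C) (xs @ x # ys) =
      join_prod K X x (decorate K X (basis_vec K F) xs) (basis_vec K (C, ys))"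
    if "F \<in> forests_with_leaves n" for F
  proof -
    have E: "(F, xs) \<in> decorated_forests X" and "F \<noteq> []"
      using that xs by (auto simp: in_decorated_forests forests_with_leaves_def forests_def)
    then show ?thesis
      using join_in_decorated_forests[OF E D x]
      by (simp add: concat_lin_basis decorate_basis join_prod_basis[OF x _ D] join_dforest_def)
  qed
qed

end

section \<open>The product of decorated forests\<close>

abbreviation dprod ::
    "('k, 'm) ring_scheme \<Rightarrow> 'k \<Rightarrow> 'x set \<Rightarrow> ('x dforest \<Rightarrow> 'k) \<Rightarrow> ('x dforest \<Rightarrow> 'k) \<Rightarrow>
     ('x dforest \<Rightarrow> 'k)"
  where "dprod K lam X \<equiv> bilin_ext K (decorated_module K X) (dforest_prod K lam X)"

context weighted_ring
begin

text \<open>The exceptional cases in \<^const>\<open>dforest_prod\<close> agree with its general formula, because the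
  single vertex is a unit for the product of forests and carries no decoration.\<close>

lemma dforest_prod_decorate:
  assumes "(F, xs) \<in> decorated_forests X" and "(F', ys) \<in> decorated_forests X"
  shows "dforest_prod K lam X (F, xs) (F', ys) = decorate K X (forest_prod K lam F F') (xs @ ys)"
proof -
  have "xs = []" if "F = [bullet]" using assms(1) that by (auto simp: in_decorated_forests)
  moreover have "ys = []" if "F' = [bullet]" using assms(2) that by (auto simp: in_decorated_forests)
  moreover have "F \<noteq> []" "F' \<noteq> []" using assms by (auto simp: in_decorated_forests)
  ultimately show ?thesis
    using decorate_basis[OF assms(1)] decorate_basis[OF assms(2)]
    by (auto simp: dforest_prod_def forest_prod_bullet_left forest_prod_bullet_right)
qed

lemma dforest_prod_carrier:
  assumes "D \<in> decorated_forests X" and "E \<in> decorated_forests X"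
  shows "dforest_prod K lam X D E \<in> carrier (decorated_module K X)"
proof -
  obtain F xs F' ys where DE: "D = (F, xs)" "E = (F', ys)" by (cases D; cases E)
  have "F \<noteq> []" "F' \<noteq> []" "set (xs @ ys) \<subseteq> X" "length (xs @ ys) + 1 = leaves F + leaves F' - 1"
    using assms by (auto simp: DE in_decorated_forests)
  then show ?thesis
    using linear_maps_closed[OF decorate_linear[of "xs @ ys" X] forest_prod_carrier]
    by (simp add: dforest_prod_decorate[OF assms[unfolded DE]] DE)
qed

lemma dprod_bilinear:
  "dprod K lam X \<in> bilinear_maps K (decorated_module K X) (decorated_module K X) (decorated_module K X)"
  by (rule bilin_ext_bilinear[OF module_free_module dforest_prod_carrier])

lemma dprod_basis:
  assumes "D \<in> decorated_forests X" and "E \<in> decorated_forests X"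
  shows "dprod K lam X (basis_vec K D) (basis_vec K E) = dforest_prod K lam X D E"
  using bilin_ext_basis[OF module_free_module, of "dforest_prod K lam X" D E]
    dforest_prod_carrier[OF assms] by blast

lemma dprod_unit_left:
  assumes v: "v \<in> carrier (decorated_module K X)"
  shows "dprod K lam X (basis_vec K ([bullet], [])) v = v"
proof (rule linear_maps_eqI[OF module_free_module _ linear_maps_ident _ v])
  show "dprod K lam X (basis_vec K ([bullet], [])) \<in>
      linear_maps K (decorated_module K X) (decorated_module K X)"
    by (rule bilinear_right[OF dprod_bilinear basis_vec_closed[OF unit_in_decorated_forests]])
  show "dprod K lam X (basis_vec K ([bullet], [])) (basis_vec K D) = basis_vec K D"
    if "D \<in> decorated_forests X" for D
    using that
    by (cases D) (auto simp: dprod_basis unit_in_decorated_forests dforest_prod_def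
        in_decorated_forests)
qed

lemma dprod_unit_right:
  assumes v: "v \<in> carrier (decorated_module K X)"
  shows "dprod K lam X v (basis_vec K ([bullet], [])) = v"
proof (rule linear_maps_eqI[OF module_free_module _ linear_maps_ident _ v])
  show "(\<lambda>v. dprod K lam X v (basis_vec K ([bullet], []))) \<in>
      linear_maps K (decorated_module K X) (decorated_module K X)"
    by (rule bilinear_left[OF dprod_bilinear basis_vec_closed[OF unit_in_decorated_forests]])
  show "dprod K lam X (basis_vec K D) (basis_vec K ([bullet], [])) = basis_vec K D"
    if "D \<in> decorated_forests X" for D
    using that
    by (cases D) (auto simp: dprod_basis unit_in_decorated_forests dforest_prod_def
        in_decorated_forests)
qed

lemma dprod_join_left:
  assumes "x \<in> X" and "u \<in> carrier (decorated_module K X)" and "v \<in> carrier (decorated_module K X)"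
    and "w \<in> carrier (decorated_module K X)"
  shows "dprod K lam X (join_prod K X x u v) w = join_prod K X x u (dprod K lam X v w)"
proof (rule trilinear_law_from_basis[OF dprod_bilinear join_prod_bilinear[OF assms(1)]
      join_prod_bilinear[OF assms(1)] dprod_bilinear])
  fix D E G assume D: "D \<in> decorated_forests X" and E: "E \<in> decorated_forests X"
    and G: "G \<in> decorated_forests X"
  obtain A ys F xs F' zs where DEG: "D = (A, ys)" "E = (F, xs)" "G = (F', zs)"
    by (cases D; cases E; cases G)
  have ne: "F \<noteq> []" "F' \<noteq> []" and xz: "set (xs @ zs) \<subseteq> X"
      "length (xs @ zs) + 1 = leaves F + leaves F' - 1"
    using E G by (auto simp: DEG in_decorated_forests)
  have "dforest_prod K lam X (join_dforest x D E) G =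
      decorate K X (concat_lin K A (forest_prod K lam F F') []) (ys @ x # (xs @ zs))"
    using dforest_prod_decorate[of "A @ F" "ys @ x # xs" X F' zs]
      join_in_decorated_forests[OF D E assms(1)] G ne
    by (simp add: DEG join_dforest_def forest_prod_concat_left)
  also have "\<dots> = join_prod K X x (basis_vec K D) (dforest_prod K lam X E G)"
    using decorate_concat_left[OF D[unfolded DEG] assms(1) forest_prod_carrier[OF ne] xz]
      dforest_prod_decorate[of F xs X F' zs] E G
    by (simp add: DEG)
  finally show "dprod K lam X (join_prod K X x (basis_vec K D) (basis_vec K E)) (basis_vec K G) =
      join_prod K X x (basis_vec K D) (dprod K lam X (basis_vec K E) (basis_vec K G))"
    using D E G assms(1) by (simp add: join_prod_basis dprod_basis join_in_decorated_forests)
qed (rule assms)+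

lemma dprod_join_right:
  assumes "x \<in> X" and "u \<in> carrier (decorated_module K X)" and "v \<in> carrier (decorated_module K X)"
    and "w \<in> carrier (decorated_module K X)"
  shows "dprod K lam X u (join_prod K X x v w) = join_prod K X x (dprod K lam X u v) w"
proof (rule trilinear_law_from_basis[OF join_prod_bilinear[OF assms(1)] dprod_bilinear
      dprod_bilinear join_prod_bilinear[OF assms(1)], symmetric])
  fix D E G assume D: "D \<in> decorated_forests X" and E: "E \<in> decorated_forests X"
    and G: "G \<in> decorated_forests X"
  obtain F xs F' zs C ys where DEG: "D = (F, xs)" "E = (F', zs)" "G = (C, ys)"
    by (cases D; cases E; cases G)
  have ne: "F \<noteq> []" "F' \<noteq> []" and xz: "set (xs @ zs) \<subseteq> X"
      "length (xs @ zs) + 1 = leaves F + leaves F' - 1"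
    using D E by (auto simp: DEG in_decorated_forests)
  have "dforest_prod K lam X D (join_dforest x E G) =
      decorate K X (concat_lin K [] (forest_prod K lam F F') C) ((xs @ zs) @ x # ys)"
    using dforest_prod_decorate[of F xs X "F' @ C" "zs @ x # ys"]
      join_in_decorated_forests[OF E G assms(1)] D ne
    by (simp add: DEG join_dforest_def forest_prod_concat_right)
  also have "\<dots> = join_prod K X x (dforest_prod K lam X D E) (basis_vec K G)"
    using decorate_concat_right[OF G[unfolded DEG] assms(1) forest_prod_carrier[OF ne] xz]
      dforest_prod_decorate[of F xs X F' zs] D E
    by (simp add: DEG)
  finally show "join_prod K X x (dprod K lam X (basis_vec K D) (basis_vec K E)) (basis_vec K G) =
      dprod K lam X (basis_vec K D) (join_prod K X x (basis_vec K E) (basis_vec K G))"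
    using D E G assms(1) by (simp add: join_prod_basis dprod_basis join_in_decorated_forests)
qed (rule assms)+

text \<open>On basis elements this is the decorated form of the recursion for the product of two trees
  that are both grafted. A basis element \<open>D = (F; xs)\<close> has \<open>F\<close> nonempty, so its graft is never the
  single vertex and the recursive clause always applies.\<close>

lemma dprod_rota_baxter:
  fixes X :: "'x set"
  defines "M \<equiv> decorated_module K X"
  assumes v: "v \<in> carrier M" and w: "w \<in> carrier M"
  shows "dprod K lam X (ShNC_op K X v) (ShNC_op K X w) =
    ShNC_op K X (dprod K lam X (ShNC_op K X v) w \<oplus>\<^bsub>M\<^esub> dprod K lam X v (ShNC_op K X w)
      \<oplus>\<^bsub>M\<^esub> lam \<odot>\<^bsub>M\<^esub> dprod K lam X v w)"
proof -
  let ?P = "ShNC_op K X" and ?m = "dprod K lam X"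
  interpret M: module K M unfolding M_def by (rule module_free_module)
  note M = M.module_axioms
  have P: "?P \<in> linear_maps K M M" unfolding M_def by (rule ShNC_op_linear)
  have m: "?m \<in> bilinear_maps K M M M" unfolding M_def by (rule dprod_bilinear)
  have lhs: "(\<lambda>v w. ?m (?P v) (?P w)) \<in> bilinear_maps K M M M"
    by (rule bilinear_maps_compose[OF m P P linear_maps_ident])
  have "(\<lambda>v w. ?m (?P v) w \<oplus>\<^bsub>M\<^esub> ?m v (?P w) \<oplus>\<^bsub>M\<^esub> lam \<odot>\<^bsub>M\<^esub> ?m v w) \<in> bilinear_maps K M M M"
    by (intro bilinear_maps_plus[OF M] bilinear_maps_scale[OF M m lam]
        bilinear_maps_compose[OF m P linear_maps_ident linear_maps_ident]
        bilinear_maps_compose[OF m linear_maps_ident P linear_maps_ident])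
  from bilinear_maps_compose[OF this linear_maps_ident linear_maps_ident P]
  have rhs: "(\<lambda>v w. ?P (?m (?P v) w \<oplus>\<^bsub>M\<^esub> ?m v (?P w) \<oplus>\<^bsub>M\<^esub> lam \<odot>\<^bsub>M\<^esub> ?m v w)) \<in>
      bilinear_maps K M M M" .
  have basis: "?m (?P (basis_vec K D)) (?P (basis_vec K E)) =
      ?P (?m (?P (basis_vec K D)) (basis_vec K E) \<oplus>\<^bsub>M\<^esub> ?m (basis_vec K D) (?P (basis_vec K E))
        \<oplus>\<^bsub>M\<^esub> lam \<odot>\<^bsub>M\<^esub> ?m (basis_vec K D) (basis_vec K E))"
    if D: "D \<in> decorated_forests X" and E: "E \<in> decorated_forests X" for D E
  proof -
    obtain F xs F' ys where DE: "D = (F, xs)" "E = (F', ys)" by (cases D; cases E)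
    define n where "n = leaves F + leaves F' - 1"
    let ?zs = "xs @ ys" and ?N = "free_module K (forests_with_leaves n)"
    interpret N: module K ?N by (rule module_free_module)
    have ne: "F \<noteq> []" "F' \<noteq> []" and zs: "set ?zs \<subseteq> X" "length ?zs + 1 = n"
      using D E by (auto simp: DE n_def in_decorated_forests)
    have D': "([Node F], xs) \<in> decorated_forests X" and E': "([Node F'], ys) \<in> decorated_forests X"
      using graft_in_decorated_forests[OF D] graft_in_decorated_forests[OF E]
      by (simp_all add: DE graft_dforest_def)
    define a where "a = forest_prod K lam [Node F] F'"
    define b where "b = forest_prod K lam F [Node F']"
    define c where "c = forest_prod K lam F F'"
    have abc: "a \<in> carrier ?N" "b \<in> carrier ?N" "c \<in> carrier ?N"
      using forest_prod_carrier[of "[Node F]" F'] forest_prod_carrier[of F "[Node F']"]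
        forest_prod_carrier[of F F'] ne by (simp_all add: a_def b_def c_def n_def)
    have gr: "graft_lin K v \<in> carrier ?N" if "v \<in> carrier ?N" for v
      using linear_maps_closed[OF graft_lin_linear that] .
    have dec: "(\<lambda>v. decorate K X v ?zs) \<in> linear_maps K ?N M"
      unfolding M_def by (rule decorate_linear[OF zs])
    note dec_gr = decorate_graft[OF _ zs]
    have "tree_prod K lam (Node F) (Node F') =
        graft_lin K a \<oplus>\<^bsub>?N\<^esub> graft_lin K b \<oplus>\<^bsub>?N\<^esub> lam \<odot>\<^bsub>?N\<^esub> graft_lin K c"
      using ne by (subst tree_prod.simps) (simp add: a_def b_def c_def free_module_simps)
    then have "decorate K X (tree_prod K lam (Node F) (Node F')) ?zs =
        ?P (decorate K X a ?zs) \<oplus>\<^bsub>M\<^esub> ?P (decorate K X b ?zs) \<oplus>\<^bsub>M\<^esub> lam \<odot>\<^bsub>M\<^esub> ?P (decorate K X c ?zs)"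
      using abc by (simp add: linear_mapsD[OF dec] gr dec_gr)
    also have "\<dots> = ?P (decorate K X a ?zs \<oplus>\<^bsub>M\<^esub> decorate K X b ?zs \<oplus>\<^bsub>M\<^esub> lam \<odot>\<^bsub>M\<^esub> decorate K X c ?zs)"
      using abc by (simp add: linear_mapsD[OF dec] linear_mapsD[OF P])
    finally show ?thesis
      using D E D' E'
      by (simp add: ShNC_op_basis DE graft_dforest_def dprod_basis dforest_prod_decorate
          forest_prod_trees a_def b_def c_def)
  qed
  show ?thesis
    using bilinear_maps_eqI[OF M[unfolded M_def] lhs[unfolded M_def] rhs[unfolded M_def] _
        v[unfolded M_def] w[unfolded M_def]] basis
    unfolding M_def by blast
qed

text \<open>If the middle factor is a join, the join laws let the outer factors act on different parts
  of it and nothing is left to prove. If an outer factor is a join, they peel off its outer part and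
  leave a smaller triple. What remains are three grafted elements.\<close>

lemma dprod_assoc_basis:
  assumes "D \<in> decorated_forests X" and "E \<in> decorated_forests X" and "G \<in> decorated_forests X"
  shows "dprod K lam X (dprod K lam X (basis_vec K D) (basis_vec K E)) (basis_vec K G) =
    dprod K lam X (basis_vec K D) (dprod K lam X (basis_vec K E) (basis_vec K G))"
  using assms
proof (induction "dforest_size D + dforest_size E + dforest_size G" arbitrary: D E G rule: less_induct)
  case less
  let ?M = "decorated_module K X" and ?b = "basis_vec K" and ?P = "ShNC_op K X"
  interpret M: module K ?M by (rule module_free_module)
  define m where "m = dprod K lam X"
  note basis [simp] = basis_vec_closed[of _ "decorated_forests X"]
  have m_closed [simp]: "m u v \<in> carrier ?M" if "u \<in> carrier ?M" "v \<in> carrier ?M" for u v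
    unfolding m_def using bilinear_closed[OF dprod_bilinear that] .
  have IH: "m (m (?b D') (?b E')) (?b G') = m (?b D') (m (?b E') (?b G'))"
    if "dforest_size D' + dforest_size E' + dforest_size G' <
        dforest_size D + dforest_size E + dforest_size G"
      "D' \<in> decorated_forests X" "E' \<in> decorated_forests X" "G' \<in> decorated_forests X" for D' E' G'
    unfolding m_def by (rule less.hyps[OF that])
  note join_simps = dprod_join_left[where X = X, folded m_def] dprod_join_right[where X = X, folded m_def]
  have "m (m (?b D) (?b E)) (?b G) = m (?b D) (m (?b E) (?b G))"
    using less.prems(2)
  proof (cases rule: decorated_forest_cases)
    case unit
    then show ?thesis
      using less.prems by (simp add: m_def dprod_unit_left dprod_unit_right)
  next
    case (join E1 E2 x)
    then show ?thesis
      using less.prems by (simp add: join_prod_basis[symmetric] join_simps)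
  next
    case E: (graft E')
    show ?thesis
      using less.prems(1)
    proof (cases rule: decorated_forest_cases)
      case unit
      then show ?thesis
        using less.prems by (simp add: m_def dprod_unit_left bilinear_closed[OF dprod_bilinear])
    next
      case (join D1 D2 x)
      then show ?thesis
        using less.prems IH[of D2 E G] dforest_size_join(2)[OF join(1,2), of x]
        by (simp add: join_prod_basis[symmetric] join_simps)
    next
      case D: (graft D')
      show ?thesis
        using less.prems(3)
      proof (cases rule: decorated_forest_cases)
        case unit
        then show ?thesis
          using less.prems by (simp add: m_def dprod_unit_right bilinear_closed[OF dprod_bilinear])
      next
        case (join G1 G2 x)
        then show ?thesis
          using less.prems IH[of D E G1] dforest_size_join(1)[OF join(1,2), of x]
          by (simp add: join_prod_basis[symmetric] join_simps)
      next
        case G: (graft G')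
        have P [simp]: "?P v \<in> carrier ?M" if "v \<in> carrier ?M" for v
          using linear_maps_closed[OF ShNC_op_linear that] .
        note dist = linear_maps_add[OF bilinear_left[OF dprod_bilinear[of X]], folded m_def]
          linear_maps_add[OF bilinear_right[OF dprod_bilinear[of X]], folded m_def]
          linear_maps_smult[OF bilinear_left[OF dprod_bilinear[of X]], folded m_def]
          linear_maps_smult[OF bilinear_right[OF dprod_bilinear[of X]], folded m_def]
        note rb = dprod_rota_baxter[where X = X, folded m_def]
        define a b c where "a = ?b D'" and "b = ?b E'" and "c = ?b G'"
        have [simp]: "a \<in> carrier ?M" "b \<in> carrier ?M" "c \<in> carrier ?M"
          using D E G by (simp_all add: a_def b_def c_def)
        have Pabc: "?b D = ?P a" "?b E = ?P b" "?b G = ?P c"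
          using D E G by (simp_all add: a_def b_def c_def ShNC_op_basis)
        note sz = dforest_size_graft[of D'] dforest_size_graft[of E'] dforest_size_graft[of G']
        \<comment> \<open>In each triple at least one of the three grafts is replaced by its smaller argument.\<close>
        have ih: "m (m (?P a) (?P b)) c = m (?P a) (m (?P b) c)"
          "m (m (?P a) b) (?P c) = m (?P a) (m b (?P c))"
          "m (m a (?P b)) (?P c) = m a (m (?P b) (?P c))"
          "m (m (?P a) b) c = m (?P a) (m b c)"
          "m (m a (?P b)) c = m a (m (?P b) c)"
          "m (m a b) (?P c) = m a (m b (?P c))"
          "m (m a b) c = m a (m b c)"
          using IH[of D E G'] IH[of D E' G] IH[of D' E G] IH[of D E' G'] IH[of D' E G'] IH[of D' E' G]
            IH[of D' E' G'] less.prems D E G sz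
          by (simp_all add: a_def b_def c_def ShNC_op_basis)
        let ?s = "\<lambda>u v. m (?P u) v \<oplus>\<^bsub>?M\<^esub> m u (?P v) \<oplus>\<^bsub>?M\<^esub> lam \<odot>\<^bsub>?M\<^esub> m u v"
        \<comment> \<open>Expanding \<open>?s (?s a b) c\<close> naively meets \<open>P\<close> of a sum; folding it back to a product of
           two grafts first leaves seven terms on each side, one for each equation in \<open>ih\<close>.\<close>
        have fold: "?P (?s a b) = m (?P a) (?P b)" "?P (?s b c) = m (?P b) (?P c)"
          by (simp_all only: rb \<open>a \<in> carrier ?M\<close> \<open>b \<in> carrier ?M\<close> \<open>c \<in> carrier ?M\<close>)
        have "m (m (?P a) (?P b)) (?P c) = ?P (?s (?s a b) c)"
          unfolding fold(1)[symmetric] by (rule rb) simp_all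
        also have "?s (?s a b) c = ?s a (?s b c)"
          unfolding fold by (simp add: dist ih M.smult_r_distr M.M.a_ac)
        also have "?P (?s a (?s b c)) = m (?P a) (m (?P b) (?P c))"
          unfolding fold(2)[symmetric] by (rule rb[symmetric]) simp_all
        finally show ?thesis by (simp only: Pabc)
      qed
    qed
  qed
  then show ?case by (simp add: m_def)
qed

lemma dprod_assoc:
  assumes "u \<in> carrier (decorated_module K X)" and "v \<in> carrier (decorated_module K X)"
    and "w \<in> carrier (decorated_module K X)"
  shows "dprod K lam X (dprod K lam X u v) w = dprod K lam X u (dprod K lam X v w)"
  using trilinear_law_from_basis[where B = "decorated_forests X" and m = "dprod K lam X"
      and n = "dprod K lam X" and m' = "dprod K lam X" and n' = "dprod K lam X"]
    dprod_bilinear dprod_assoc_basis assms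
  by blast

lemma ShNC_simps [simp]:
  "carrier (ShNC K lam X) = carrier (decorated_module K X)"
  "v \<oplus>\<^bsub>ShNC K lam X\<^esub> w = v \<oplus>\<^bsub>decorated_module K X\<^esub> w"
  "\<zero>\<^bsub>ShNC K lam X\<^esub> = \<zero>\<^bsub>decorated_module K X\<^esub>"
  "a \<odot>\<^bsub>ShNC K lam X\<^esub> v = a \<odot>\<^bsub>decorated_module K X\<^esub> v"
  "v \<otimes>\<^bsub>ShNC K lam X\<^esub> w = dprod K lam X v w"
  "\<one>\<^bsub>ShNC K lam X\<^esub> = basis_vec K ([bullet], [])"
  by (simp_all add: ShNC_def)

lemma linear_maps_ShNC:
  "linear_maps K (ShNC K lam X) A = linear_maps K (decorated_module K X) A"
  "linear_maps K A (ShNC K lam X) = linear_maps K A (decorated_module K X)"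
  by (simp_all add: linear_maps_def)

lemma ShNC_rota_baxter: "unitary_rota_baxter_algebra K lam (ShNC K lam X) (ShNC_op K X)"
proof -
  let ?M = "decorated_module K X" and ?A = "ShNC K lam X"
  interpret M: module K ?M by (rule module_free_module)
  have group: "abelian_group ?A"
    by (rule abelian_groupI)
      (auto simp: M.M.a_ac intro: bexI[where x = "\<ominus>\<^bsub>?M\<^esub> _"] simp: M.M.l_neg)
  have mod: "module K ?A"
    by (rule moduleI)
      (simp_all add: group is_cring M.smult_l_distr M.smult_r_distr M.smult_assoc1)
  have ring: "ring ?A"
  proof (rule ringI[OF group])
    show "monoid ?A"
      by (rule monoidI) (simp_all add: bilinear_closed[OF dprod_bilinear] dprod_assoc
          dprod_unit_left dprod_unit_right basis_vec_closed unit_in_decorated_forests)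
  qed (simp_all add: linear_maps_add[OF bilinear_left[OF dprod_bilinear]]
      linear_maps_add[OF bilinear_right[OF dprod_bilinear]])
  show ?thesis
  proof (intro unitary_rota_baxter_algebra.intro unitary_algebra.intro
      unitary_algebra_axioms.intro unitary_rota_baxter_algebra_axioms.intro mod ring)
    show "ShNC_op K X \<in> linear_maps K ?A ?A" by (simp add: linear_maps_ShNC ShNC_op_linear)
  qed (simp_all add: linear_maps_smult[OF bilinear_left[OF dprod_bilinear]]
      linear_maps_smult[OF bilinear_right[OF dprod_bilinear]] dprod_rota_baxter)
qed

lemma ShNC_gen_eq:
  assumes "x \<in> X"
  shows "ShNC_gen K x =
    join_prod K X x (basis_vec K ([bullet], [])) (basis_vec K ([bullet], []))"
  using assms
  by (simp add: join_prod_basis unit_in_decorated_forests ShNC_gen_def join_dforest_def)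

lemma ShNC_gen_closed:
  assumes "x \<in> X"
  shows "ShNC_gen K x \<in> carrier (decorated_module K X)"
  using assms by (auto simp: ShNC_gen_def in_decorated_forests intro!: basis_vec_closed)

text \<open>As \<open>j(x) = 1 \<squnion>\<^sub>x 1\<close>, multiplying by \<open>u\<close> and \<open>v\<close> on the two sides replaces the two units.
  Hence the algebra structure together with the \<open>j(x)\<close> determines the joins.\<close>

lemma join_prod_eq_dprod:
  assumes x: "x \<in> X" and v: "v \<in> carrier (decorated_module K X)"
    and w: "w \<in> carrier (decorated_module K X)"
  shows "join_prod K X x v w = dprod K lam X (dprod K lam X v (ShNC_gen K x)) w"
  using assms
  by (simp add: ShNC_gen_eq dprod_join_right dprod_join_left dprod_unit_left dprod_unit_right
      basis_vec_closed unit_in_decorated_forests bilinear_closed[OF join_prod_bilinear])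

end

section \<open>Evaluation in a Rota--Baxter algebra\<close>

text \<open>The value forced on a decorated forest by a morphism. The decorations are distributed as in
  \<open>decorated_forest_cases\<close>: a first tree with \<open>k + 1\<close> leaves uses positions \<open>0, \<dots>, k - 1\<close>, position
  \<open>k\<close> is the angle behind it, and the rest goes to the remaining trees.\<close>

fun eval_forest ::
    "('r, 'n) ring_scheme \<Rightarrow> ('r \<Rightarrow> 'r) \<Rightarrow> ('x \<Rightarrow> 'r) \<Rightarrow> pforest \<Rightarrow> 'x list \<Rightarrow> 'r"
  where
    "eval_forest R P f [] xs = \<one>\<^bsub>R\<^esub>"
  | "eval_forest R P f [Node F] xs = (if F = [] then \<one>\<^bsub>R\<^esub> else P (eval_forest R P f F xs))"
  | "eval_forest R P f (T # U # G) xs =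
      eval_forest R P f [T] (take (tree_leaves T - 1) xs) \<otimes>\<^bsub>R\<^esub>
      (f (xs ! (tree_leaves T - 1)) \<otimes>\<^bsub>R\<^esub> eval_forest R P f (U # G) (drop (tree_leaves T) xs))"

locale rota_baxter_target =
  weighted_ring K lam + unitary_rota_baxter_algebra K lam R P
  for K :: "('k, 'm) ring_scheme" (structure) and lam and R :: "('k, 'r, 'n) module_scheme" (structure)
    and P +
  fixes X :: "'x set" and f
  assumes f_closed: "f \<in> X \<rightarrow> carrier R"
begin

lemma f_carrier [simp]: "x \<in> X \<Longrightarrow> f x \<in> carrier R"
  using f_closed by auto

lemma f_carrier_nth [simp]: "\<lbrakk>set xs \<subseteq> X; k < length xs\<rbrakk> \<Longrightarrow> f (xs ! k) \<in> carrier R"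
  by (meson f_carrier nth_mem subsetD)

lemma P_closed [simp]: "r \<in> carrier R \<Longrightarrow> P r \<in> carrier R"
  by (rule linear_maps_closed[OF operator_linear])

lemma eval_forest_closed:
  "\<lbrakk>set xs \<subseteq> X; length xs + 1 = leaves F\<rbrakk> \<Longrightarrow> eval_forest R P f F xs \<in> carrier R"
proof (induction F arbitrary: xs rule: measure_induct_rule[of "size_list size"])
  case (less F)
  consider "F = []" | F' where "F = [Node F']" | T U G where "F = T # U # G"
    by (metis list.exhaust ptree.exhaust)
  then show ?case
  proof cases
    case 2
    then show ?thesis using less.IH[of F' xs] less.prems by auto
  next
    case 3
    define k where "k = tree_leaves T - 1"
    have k: "tree_leaves T = Suc k" "k < length xs" "length xs - k = leaves (U # G)"
      using tree_leaves_pos[of T] leaves_pos[of "U # G"] less.prems by (auto simp: k_def 3)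
    have "eval_forest R P f [T] (take k xs) \<in> carrier R"
      using less.IH[of "[T]" "take k xs"] less.prems k set_take_subset[of k xs] by (auto simp: 3)
    moreover have "eval_forest R P f (U # G) (drop (Suc k) xs) \<in> carrier R"
      using less.IH[of "U # G" "drop (Suc k) xs"] less.prems k set_drop_subset[of "Suc k" xs]
      by (auto simp: 3)
    ultimately show ?thesis using k less.prems by (simp add: 3)
  qed auto
qed

text \<open>The recursion cuts a forest after its first tree; by associativity of the target every other
  cut gives the same value.\<close>

lemma eval_forest_append:
  assumes "x \<in> X" and "(F, xs) \<in> decorated_forests X" and "(G, ys) \<in> decorated_forests X"
  shows "eval_forest R P f (F @ G) (xs @ x # ys) =
    eval_forest R P f F xs \<otimes>\<^bsub>R\<^esub> (f x \<otimes>\<^bsub>R\<^esub> eval_forest R P f G ys)"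
  using assms(2)
proof (induction F arbitrary: xs)
  case Nil
  then show ?case by (simp add: in_decorated_forests)
next
  case (Cons T F)
  have G: "G \<noteq> []" "eval_forest R P f G ys \<in> carrier R"
    using assms(3) by (auto simp: in_decorated_forests intro: eval_forest_closed)
  define k where "k = tree_leaves T - 1"
  have k: "tree_leaves T = Suc k" using tree_leaves_pos[of T] by (simp add: k_def)
  show ?case
  proof (cases F)
    case Nil
    then have "length xs = k" using Cons.prems k by (simp add: in_decorated_forests)
    then show ?thesis using G k by (cases G) (auto simp: Nil)
  next
    case F: (Cons U F')
    have len: "k < length xs" "length xs - k = leaves F" and xs: "set xs \<subseteq> X"
      using Cons.prems k leaves_pos[of F] by (auto simp: F in_decorated_forests)
    have dec: "(F, drop (Suc k) xs) \<in> decorated_forests X"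
      using len xs set_drop_subset[of "Suc k" xs] by (auto simp: F in_decorated_forests)
    have T: "eval_forest R P f [T] (take k xs) \<in> carrier R"
      using eval_forest_closed[of "take k xs" "[T]"] len k xs set_take_subset[of k xs] by auto
    have F_closed: "eval_forest R P f F (drop (Suc k) xs) \<in> carrier R"
      using dec by (intro eval_forest_closed) (auto simp: in_decorated_forests)
    show ?thesis
      using Cons.IH[OF dec] len k xs T F_closed G assms(1)
      by (simp add: F nth_append m_assoc)
  qed
qed

definition eval_lin :: "('x dforest \<Rightarrow> 'k) \<Rightarrow> 'r"
  where "eval_lin = lin_ext K R (\<lambda>D. eval_forest R P f (fst D) (snd D))"

lemma eval_dforest_closed:
  "D \<in> decorated_forests X \<Longrightarrow> eval_forest R P f (fst D) (snd D) \<in> carrier R"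
  by (cases D) (auto simp: in_decorated_forests intro: eval_forest_closed)

lemma eval_lin_linear: "eval_lin \<in> linear_maps K (decorated_module K X) R"
  unfolding eval_lin_def
  by (rule lin_ext_linear[OF module_axioms]) (use eval_dforest_closed in blast)

lemma eval_lin_basis:
  assumes "D \<in> decorated_forests X"
  shows "eval_lin (basis_vec K D) = eval_forest R P f (fst D) (snd D)"
  using lin_ext_basis[OF module_axioms, of "\<lambda>D. eval_forest R P f (fst D) (snd D)" D]
    eval_dforest_closed[OF assms]
  unfolding eval_lin_def by blast

lemma eval_lin_op:
  assumes v: "v \<in> carrier (decorated_module K X)"
  shows "eval_lin (ShNC_op K X v) = P (eval_lin v)"
proof (rule linear_maps_eqI[OF module_axioms linear_maps_compose[OF ShNC_op_linear eval_lin_linear]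
      linear_maps_compose[OF eval_lin_linear operator_linear] _ v])
  show "eval_lin (ShNC_op K X (basis_vec K D)) = P (eval_lin (basis_vec K D))"
    if "D \<in> decorated_forests X" for D
  proof -
    have "fst D \<noteq> []" using that by (cases D) (simp add: in_decorated_forests)
    then show ?thesis
      using that graft_in_decorated_forests[OF that]
      by (simp add: ShNC_op_basis eval_lin_basis) (simp add: graft_dforest_def)
  qed
qed

lemma mult_bilinear: "(\<otimes>\<^bsub>R\<^esub>) \<in> bilinear_maps K R R R"
  unfolding bilinear_maps_def
  by (auto intro!: linear_mapsI simp: l_distr r_distr smult_mult_left smult_mult_right)

lemma eval_lin_join:
  assumes x: "x \<in> X" and v: "v \<in> carrier (decorated_module K X)"
    and w: "w \<in> carrier (decorated_module K X)"
  shows "eval_lin (join_prod K X x v w) = eval_lin v \<otimes>\<^bsub>R\<^esub> (f x \<otimes>\<^bsub>R\<^esub> eval_lin w)"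
proof (rule bilinear_maps_eqI[OF module_axioms _ _ _ v w])
  show "(\<lambda>v w. eval_lin (join_prod K X x v w)) \<in>
      bilinear_maps K (decorated_module K X) (decorated_module K X) R"
    by (rule bilinear_maps_compose[OF join_prod_bilinear[OF x] linear_maps_ident linear_maps_ident
          eval_lin_linear])
  show "(\<lambda>v w. eval_lin v \<otimes>\<^bsub>R\<^esub> (f x \<otimes>\<^bsub>R\<^esub> eval_lin w)) \<in>
      bilinear_maps K (decorated_module K X) (decorated_module K X) R"
    by (rule bilinear_maps_compose[OF mult_bilinear eval_lin_linear
          linear_maps_compose[OF eval_lin_linear bilinear_right[OF mult_bilinear f_carrier[OF x]]]
          linear_maps_ident])
  fix D E assume D: "D \<in> decorated_forests X" and E: "E \<in> decorated_forests X"
  then show "eval_lin (join_prod K X x (basis_vec K D) (basis_vec K E)) =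
      eval_lin (basis_vec K D) \<otimes>\<^bsub>R\<^esub> (f x \<otimes>\<^bsub>R\<^esub> eval_lin (basis_vec K E))"
    using eval_forest_append[OF x, of "fst D" "snd D" "fst E" "snd E"]
      join_in_decorated_forests[OF D E x]
    by (simp add: join_prod_basis[OF x] eval_lin_basis) (simp add: join_dforest_def)
qed

lemma eval_lin_unit: "eval_lin (basis_vec K ([bullet], [])) = \<one>\<^bsub>R\<^esub>"
  by (simp add: eval_lin_basis unit_in_decorated_forests)

text \<open>The induction mirrors the one for associativity: for joins it uses associativity of the
  target, for two grafts the Rota--Baxter identity on both sides.\<close>

lemma eval_lin_prod_basis:
  assumes "D \<in> decorated_forests X" and "E \<in> decorated_forests X"
  shows "eval_lin (dprod K lam X (basis_vec K D) (basis_vec K E)) =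
    eval_lin (basis_vec K D) \<otimes>\<^bsub>R\<^esub> eval_lin (basis_vec K E)"
  using assms
proof (induction "dforest_size D + dforest_size E" arbitrary: D E rule: less_induct)
  case less
  let ?M = "decorated_module K X" and ?b = "basis_vec K"
  note [simp] = basis_vec_closed[of _ "decorated_forests X"] bilinear_closed[OF dprod_bilinear]
    linear_maps_closed[OF eval_lin_linear] linear_maps_closed[OF ShNC_op_linear]
  show ?case
    using less.prems(1)
  proof (cases rule: decorated_forest_cases)
    case unit
    then show ?thesis using less.prems by (simp add: dprod_unit_left eval_lin_unit)
  next
    case (join D1 D2 x)
    then show ?thesis
      using less.prems less.hyps[of D2 E] dforest_size_join(2)[OF join(1,2), of x]
      by (simp add: join_prod_basis[symmetric] dprod_join_left eval_lin_join m_assoc)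
  next
    case D: (graft D')
    show ?thesis
      using less.prems(2)
    proof (cases rule: decorated_forest_cases)
      case unit
      then show ?thesis using less.prems by (simp add: dprod_unit_right eval_lin_unit)
    next
      case (join E1 E2 x)
      then show ?thesis
        using less.prems less.hyps[of D E1] dforest_size_join(1)[OF join(1,2), of x]
        by (simp add: join_prod_basis[symmetric] dprod_join_right eval_lin_join m_assoc)
    next
      case E: (graft E')
      interpret M: module K ?M by (rule module_free_module)
      define a b where "a = ?b D'" and "b = ?b E'"
      have [simp]: "a \<in> carrier ?M" "b \<in> carrier ?M" using D E by (simp_all add: a_def b_def)
      have Pab: "?b D = ShNC_op K X a" "?b E = ShNC_op K X b"
        using D E by (simp_all add: a_def b_def ShNC_op_basis)
      have ih: "eval_lin (dprod K lam X (ShNC_op K X a) b) = P (eval_lin a) \<otimes>\<^bsub>R\<^esub> eval_lin b"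
        "eval_lin (dprod K lam X a (ShNC_op K X b)) = eval_lin a \<otimes>\<^bsub>R\<^esub> P (eval_lin b)"
        "eval_lin (dprod K lam X a b) = eval_lin a \<otimes>\<^bsub>R\<^esub> eval_lin b"
        using less.hyps[of D E'] less.hyps[of D' E] less.hyps[of D' E'] less.prems D(1) E(1)
          dforest_size_graft[of D'] dforest_size_graft[of E'] eval_lin_op[of a] eval_lin_op[of b]
        by (simp_all add: Pab[symmetric] a_def[symmetric] b_def[symmetric] D(2)[symmetric] E(2)[symmetric])
      show ?thesis
        by (simp add: Pab dprod_rota_baxter eval_lin_op linear_mapsD[OF eval_lin_linear] ih rota_baxter)
    qed
  qed
qed

lemma eval_lin_prod:
  assumes v: "v \<in> carrier (decorated_module K X)" and w: "w \<in> carrier (decorated_module K X)"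
  shows "eval_lin (dprod K lam X v w) = eval_lin v \<otimes>\<^bsub>R\<^esub> eval_lin w"
  by (rule bilinear_maps_eqI[OF module_axioms
        bilinear_maps_compose[OF dprod_bilinear linear_maps_ident linear_maps_ident eval_lin_linear]
        bilinear_maps_compose[OF mult_bilinear eval_lin_linear eval_lin_linear linear_maps_ident]
        eval_lin_prod_basis v w])

lemma eval_lin_gen:
  assumes "x \<in> X"
  shows "eval_lin (ShNC_gen K x) = f x"
  using assms
  by (simp add: ShNC_gen_eq eval_lin_join eval_lin_unit basis_vec_closed unit_in_decorated_forests)

lemma eval_lin_morphism:
  "restrict eval_lin (carrier (ShNC K lam X)) \<in>
    rota_baxter_morphisms K (ShNC K lam X) (ShNC_op K X) R P"
proof -
  interpret A: unitary_rota_baxter_algebra K lam "ShNC K lam X" "ShNC_op K X"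
    by (rule ShNC_rota_baxter)
  let ?A = "ShNC K lam X"
  have lin: "eval_lin \<in> linear_maps K ?A R" by (simp only: linear_maps_ShNC eval_lin_linear)
  note [simp del] = ShNC_simps
  have one: "\<one>\<^bsub>?A\<^esub> = basis_vec K ([bullet], [])" by (simp only: ShNC_simps)
  have mult: "eval_lin (v \<otimes>\<^bsub>?A\<^esub> w) = eval_lin v \<otimes>\<^bsub>R\<^esub> eval_lin w"
    and opr: "eval_lin (ShNC_op K X v) = P (eval_lin v)"
    if "v \<in> carrier ?A" "w \<in> carrier ?A" for v w
    using that by (simp_all add: ShNC_simps eval_lin_prod eval_lin_op)
  show ?thesis
    unfolding rota_baxter_morphisms_def ring_hom_def linear_maps_def
    by (auto simp: linear_mapsD[OF lin] linear_maps_closed[OF A.operator_linear] mult opr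
        eval_lin_unit[folded one])
qed

text \<open>The set of basis elements on which two morphisms agree is closed under grafting, since they
  commute with the operators, and under joins, since these are products with
  some \<open>j(x)\<close>, where the morphisms agree.\<close>

lemma morphism_unique:
  assumes g: "g \<in> rota_baxter_morphisms K (ShNC K lam X) (ShNC_op K X) R P"
    and h: "h \<in> rota_baxter_morphisms K (ShNC K lam X) (ShNC_op K X) R P"
    and gen: "\<And>x. x \<in> X \<Longrightarrow> g (ShNC_gen K x) = h (ShNC_gen K x)"
  shows "g = h"
proof -
  let ?M = "decorated_module K X"
  note [simp] = basis_vec_closed[of _ "decorated_forests X"] bilinear_closed[OF dprod_bilinear]
    ShNC_gen_closed
  have morph: "k \<in> linear_maps K ?M R" "k \<in> extensional (carrier ?M)"
      "k (basis_vec K ([bullet], [])) = \<one>\<^bsub>R\<^esub>"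
      "\<And>v. v \<in> carrier ?M \<Longrightarrow> k (ShNC_op K X v) = P (k v)"
      "\<And>v w. v \<in> carrier ?M \<Longrightarrow> w \<in> carrier ?M \<Longrightarrow> k (dprod K lam X v w) = k v \<otimes>\<^bsub>R\<^esub> k w"
    if "k \<in> rota_baxter_morphisms K (ShNC K lam X) (ShNC_op K X) R P" for k
    using that by (auto simp: rota_baxter_morphisms_def ring_hom_def linear_maps_ShNC)
  have basis: "g (basis_vec K D) = h (basis_vec K D)" if "D \<in> decorated_forests X" for D
    using that
  proof (induction rule: decorated_forest_induct)
    case unit
    then show ?case by (simp add: morph(3)[OF g] morph(3)[OF h])
  next
    case (graft D)
    then show ?case
      by (simp add: ShNC_op_basis[symmetric] morph(4)[OF g] morph(4)[OF h])
  next
    case (join D E x)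
    then show ?case
      by (simp add: join_prod_basis[symmetric] join_prod_eq_dprod morph(5)[OF g] morph(5)[OF h] gen)
  qed
  show ?thesis
  proof (rule extensionalityI[OF morph(2)[OF g] morph(2)[OF h]])
    show "g v = h v" if "v \<in> carrier ?M" for v
      by (rule linear_maps_eqI[OF module_axioms morph(1)[OF g] morph(1)[OF h] basis that])
  qed
qed

end

section \<open>The free Rota--Baxter algebra\<close>

theorem theorem3p8:
  fixes K :: "('k, 'm) ring_scheme" and lam :: 'k and X :: "'x set"
  assumes "cring K" and "lam \<in> carrier K"
  shows "unitary_rota_baxter_algebra K lam (ShNC K lam X) (ShNC_op K X) \<and>
    ShNC_gen K \<in> X \<rightarrow> carrier (ShNC K lam X) \<and>
    (\<forall>(R :: ('k, 'r, 'n) module_scheme) P f.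
       unitary_rota_baxter_algebra K lam R P \<longrightarrow> f \<in> X \<rightarrow> carrier R \<longrightarrow>
       (\<exists>!fbar. fbar \<in> rota_baxter_morphisms K (ShNC K lam X) (ShNC_op K X) R P \<and>
                (\<forall>x\<in>X. fbar (ShNC_gen K x) = f x)))"
proof (intro conjI allI impI)
  interpret weighted_ring K lam
    using assms by (intro weighted_ring.intro coefficient_ring.intro weighted_ring_axioms.intro)
  show "unitary_rota_baxter_algebra K lam (ShNC K lam X) (ShNC_op K X)"
    by (rule ShNC_rota_baxter)
  show "ShNC_gen K \<in> X \<rightarrow> carrier (ShNC K lam X)"
    by (simp add: ShNC_gen_closed)
  fix R :: "('k, 'r, 'n) module_scheme" and P f
  assume "unitary_rota_baxter_algebra K lam R P" and "f \<in> X \<rightarrow> carrier R"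
  then interpret rota_baxter_target K lam R P X f
    by (intro rota_baxter_target.intro rota_baxter_target_axioms.intro weighted_ring_axioms)
  show "\<exists>!fbar. fbar \<in> rota_baxter_morphisms K (ShNC K lam X) (ShNC_op K X) R P \<and>
                (\<forall>x\<in>X. fbar (ShNC_gen K x) = f x)"
  proof (rule ex1I[of _ "restrict eval_lin (carrier (ShNC K lam X))"])
    show "restrict eval_lin (carrier (ShNC K lam X)) \<in>
        rota_baxter_morphisms K (ShNC K lam X) (ShNC_op K X) R P \<and>
        (\<forall>x\<in>X. restrict eval_lin (carrier (ShNC K lam X)) (ShNC_gen K x) = f x)"
      using eval_lin_morphism by (simp only: ShNC_simps) (simp add: eval_lin_gen ShNC_gen_closed)
  next
    fix g assume "g \<in> rota_baxter_morphisms K (ShNC K lam X) (ShNC_op K X) R P \<and>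
                (\<forall>x\<in>X. g (ShNC_gen K x) = f x)"
    then show "g = restrict eval_lin (carrier (ShNC K lam X))"
      by (intro morphism_unique eval_lin_morphism) (simp_all add: eval_lin_gen ShNC_gen_closed)
  qed
qed

end
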